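(* Let $q$ be a prime power and let $k>1$ and $n$ be positive integers with $\gcd(k,n+1)=1$. Let $$\lambda=\frac{q^{\binom{n+1}{2}k}(q^k-1)(q^n-1)}{q^{k-1}(n+1)(q-1)}\prod_{i=1}^{n-1}(q^{ki}-1)\quad\text{and}\quad v=\frac{q^{k(n+1)}-1}{q^k-1}.$$ Then there exists a simple $\left(q\frac{q^n-1}{q-1}\right)$-factorization of $\lambda K_v$ induced by the set of those projectivities which act cyclically on a subgeometry $\mathrm{PG}(n,q)$ of $\mathrm{PG}(n,q^k)$ such that they determine different partitions; that is, the family of factors $F_{\mathcal{P}}$, where $\mathcal{P}$ ranges over the distinct partitions of $\mathrm{PG}(n,q^k)$ into subgeometries $\mathrm{PG}(n,q)$ determined by such projectivities, is a simple $\left(q\frac{q^n-1}{q-1}\right)$-factorization of $\lambda K_v$.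
   Context: The complete multigraph $\lambda K_v$ has $v$ vertices and exactly $\lambda$ edges joining each pair of distinct vertices. An $m$-factor of $\lambda K_v$ is a spanning $m$-regular subgraph. An $m$-factorization of $\lambda K_v$ is a collection of pairwise edge-disjoint $m$-factors which partition the edges; equivalently, regarding factors as graphs on the $v$ vertices, a family (multiset) of $m$-regular simple spanning graphs (all factors here are simple graphs) such that each pair of distinct vertices is joined in exactly $\lambda$ of them. It is simple if its $m$-factors are pairwise distinct (as graphs on the vertex set). The vertices of $\lambda K_v$ are identified with the $v$ points of $\mathrm{PG}(n,q^k)$. A subgeometry $\mathrm{PG}(n,q)$ of $\mathrm{PG}(n,q^k)$ is an image under a projectivity of $\mathrm{PG}(n,q^k)$ of the set of points having homogeneous coordinates in the subfield $\mathrm{GF}(q)$. A projectivity $\sigma$ of $\mathrm{PG}(n,q^k)$ acts cyclically on a subgeometry $\mathrm{PG}(n,q)$ if it maps this subgeometry to itself and permutes its $\frac{q^{n+1}-1}{q-1}$ points in a single cycle. When $\gcd(k,n+1)=1$, the orbits of such a $\sigma$ on the points of $\mathrm{PG}(n,q^k)$ are subgeometries $\mathrm{PG}(n,q)$, and the partition determined by $\sigma$ is the partition of the points of $\mathrm{PG}(n,q^k)$ into these orbits. For such a partition $\mathcal{P}$, $F_{\mathcal{P}}$ is the vertex-disjoint union of the complete graphs on the parts of $\mathcal{P}$; it is a $\left(q\frac{q^n-1}{q-1}\right)$-factor. *)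

theory Defs
  imports
    "HOL-Analysis.Cartesian_Space"
    "HOL-Number_Theory.Prime_Powers"
    "HOL-Combinatorics.Orbits"
    "HOL-Library.Multiset"
begin

section \<open>Factorizations of complete multigraphs\<close>

text \<open>
  A simple graph on the vertex set \<open>V\<close> is represented by its set of edges, an edge being a
  two-element subset of \<open>V\<close>. All factors are spanning, so the edge set determines the graph.
\<close>

definition simple_graph :: "'v set \<Rightarrow> 'v set set \<Rightarrow> bool" where
  "simple_graph V E \<longleftrightarrow> (\<forall>e\<in>E. e \<subseteq> V \<and> card e = 2)"

definition is_factor :: "nat \<Rightarrow> 'v set \<Rightarrow> 'v set set \<Rightarrow> bool" where
  "is_factor m V E \<longleftrightarrow> simple_graph V E \<and> (\<forall>x\<in>V. card {e\<in>E. x \<in> e} = m)"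

text \<open>
  An \<open>m\<close>-factorization of \<open>lam K\<^sub>v\<close>, where \<open>v\<close> is the cardinality of \<open>V\<close>: a multiset of
  \<open>m\<close>-factors such that each pair of distinct vertices is joined in exactly \<open>lam\<close> of them,
  counted with multiplicity.
\<close>

definition is_factorization :: "nat \<Rightarrow> nat \<Rightarrow> 'v set \<Rightarrow> 'v set set multiset \<Rightarrow> bool" where
  "is_factorization m lam V \<F> \<longleftrightarrow>
     (\<forall>E\<in>#\<F>. is_factor m V E) \<and>
     (\<forall>x\<in>V. \<forall>y\<in>V. x \<noteq> y \<longrightarrow> size {# E \<in># \<F>. {x, y} \<in> E #} = lam)"

definition is_simple_factorization :: "nat \<Rightarrow> nat \<Rightarrow> 'v set \<Rightarrow> 'v set set multiset \<Rightarrow> bool" where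
  "is_simple_factorization m lam V \<F> \<longleftrightarrow>
     is_factorization m lam V \<F> \<and> (\<forall>E\<in>#\<F>. count \<F> E = 1)"

definition complete_graph :: "'v set \<Rightarrow> 'v set set" where
  "complete_graph B = {e. e \<subseteq> B \<and> card e = 2}"

definition partition_factor :: "'v set set \<Rightarrow> 'v set set" where
  "partition_factor P = (\<Union>B\<in>P. complete_graph B)"

section \<open>Projective spaces over finite fields\<close>

text \<open>
  If \<open>'a\<close> is a field with \<open>Q\<close> elements and \<open>'n\<close> has \<open>n + 1\<close> elements, then \<open>pg_points\<close>
  is the point set of \<open>PG(n, Q)\<close>.
\<close>

definition pg_points :: "('a::field ^ 'n) set set" where
  "pg_points = {U. vec.subspace U \<and> vec.dim U = 1}"

text \<open>A projectivity is regarded as a map on points; its values elsewhere are irrelevant.\<close>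

definition projectivity :: "(('a::field ^ 'n) set \<Rightarrow> ('a ^ 'n) set) \<Rightarrow> bool" where
  "projectivity \<sigma> \<longleftrightarrow>
     (\<exists>A :: 'a ^ 'n ^ 'n. invertible A \<and> (\<forall>U\<in>pg_points. \<sigma> U = (\<lambda>x. A *v x) ` U))"

definition is_subfield :: "'a::field set \<Rightarrow> bool" where
  "is_subfield F \<longleftrightarrow> 0 \<in> F \<and> 1 \<in> F \<and>
     (\<forall>x\<in>F. \<forall>y\<in>F. x + y \<in> F \<and> x * y \<in> F) \<and> (\<forall>x\<in>F. - x \<in> F \<and> inverse x \<in> F)"

text \<open>The points having some vector of homogeneous coordinates with all entries in \<open>F\<close>.\<close>

definition points_over :: "'a::field set \<Rightarrow> ('a ^ 'n) set set" where
  "points_over F = {vec.span {x} | x. x \<noteq> 0 \<and> (\<forall>i. x $ i \<in> F)}"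

text \<open>
  The subgeometries \<open>PG(n, q)\<close>. A finite field has at most one subfield with \<open>q\<close> elements, so
  \<open>F\<close> below is the subfield \<open>GF(q)\<close>.
\<close>

definition subgeometry :: "nat \<Rightarrow> ('a::field ^ 'n) set set \<Rightarrow> bool" where
  "subgeometry q B \<longleftrightarrow>
     (\<exists>F \<tau>. is_subfield F \<and> card F = q \<and> projectivity \<tau> \<and> B = \<tau> ` points_over F)"

definition acts_cyclically ::
  "(('a::field ^ 'n) set \<Rightarrow> ('a ^ 'n) set) \<Rightarrow> ('a ^ 'n) set set \<Rightarrow> bool" where
  "acts_cyclically \<sigma> B \<longleftrightarrow> \<sigma> ` B = B \<and> cyclic_on \<sigma> B"

definition determined_partition ::
  "(('a::field ^ 'n) set \<Rightarrow> ('a ^ 'n) set) \<Rightarrow> ('a ^ 'n) set set set" where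
  "determined_partition \<sigma> = orbit \<sigma> ` pg_points"

definition cyclic_partitions :: "nat \<Rightarrow> ('a::field ^ 'n) set set set set" where
  "cyclic_partitions q =
     {determined_partition \<sigma> | \<sigma>. projectivity \<sigma> \<and> (\<exists>B. subgeometry q B \<and> acts_cyclically \<sigma> B)}"

text \<open>
  The family of the factors of all distinct partitions. It is a multiset, so that coincidences
  between factors of different partitions would be visible as multiplicities.
\<close>

definition cyclic_factors :: "nat \<Rightarrow> ('a::{field,finite} ^ 'n) set set set multiset" where
  "cyclic_factors q = image_mset partition_factor (mset_set (cyclic_partitions q))"

end

theory Submission
  imports Defs "HOL-Algebra.Algebraic_Closure_Type" "HOL-Number_Theory.Residues"
begin

text \<open>
  Put \<open>N = n + 1\<close>, \<open>Q = q ^ k\<close>, \<open>F = GF(Q)\<close> and \<open>V = F\<^sup>N\<close>, and let \<open>E = GF(q ^ N)\<close> and \<open>L = GF(Q ^ N)\<close> inside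
  the algebraic closure of \<open>F\<close>. Every \<open>F\<close>-linear bijection \<open>\<zeta>\<close> from \<open>V\<close> to \<open>L\<close> defines a partition
  \<open>block_partition \<zeta>\<close> of the points: two points belong to the same part if the quotient of their
  \<open>\<zeta>\<close>-values is the product of a nonzero element of \<open>F\<close> and a nonzero element of \<open>E\<close>. The proof studies
  these partitions instead of projectivities.

  \<^item> They are exactly the partitions in question (\<open>cyclic_partitions_eq\<close>). In one direction, the
    projectivity is multiplication by a generator of the multiplicative group of \<open>E\<close>. In the other, a
    projectivity that acts cyclically on a subgeometry has, over the algebraic closure, an
    eigenfunctional; if this is scaled to take the value \<open>1\<close>, cyclicity forces its values on the lattice of the subgeometry to be the field
    \<open>E\<close>, so the eigenfunctional is itself a bijection from \<open>V\<close> to \<open>L\<close>.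

  \<^item> Two bijections \<open>\<zeta>\<close> and \<open>\<zeta>'\<close> define the same partition if and only if \<open>\<zeta>' = c \<zeta>\<^sup>s\<close> for a nonzero
    \<open>c\<close> in \<open>L\<close> and one of the \<open>N\<close> exponents \<open>s = Q ^ i\<close> with \<open>i < N\<close> (\<open>same_classes_iff_twist\<close>). The
    substance is \<open>partition_preserving_semilinear\<close>: an \<open>F\<close>-linear map of \<open>L\<close> that permutes the classes is,
    up to a scalar, a field automorphism, because it respects the \<open>E\<close>-lines of \<open>L\<close> and \<open>L\<close> has dimension
    \<open>k > 1\<close> over \<open>E\<close>. So every partition arises from exactly \<open>N (Q ^ N - 1)\<close> bijections, whose total
    number is the order of the general linear group.

  \<^item> The general linear group acts on the bijections and is transitive on pairs of distinct points,
    so every such pair is joined equally often, and \<open>\<lambda>\<close> results from double counting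
    (\<open>card_joining\<close>). All parts have \<open>(q ^ N - 1) / (q - 1)\<close> points, which gives the degree of the
    factors; and a factor determines its partition, so the factors are pairwise distinct.
\<close>

section \<open>Finite subfields of an algebraically closed field\<close>

text \<open>
  The elements of a field with \<open>x\<^sup>m = x\<close>. Inside an algebraically closed field of
  characteristic \<open>p\<close> this is the subfield \<open>GF(m)\<close> when \<open>m > 1\<close> is a power of \<open>p\<close>, so all the finite
  fields of the proof are available at once as subsets of one type.
\<close>

definition gf :: "nat \<Rightarrow> 'c::field set" where
  "gf m = {x. x ^ m = x}"

text \<open>
  Multiplication by an element permutes the set, so the product of the set does not change when
  every factor is multiplied by that element.
\<close>

lemma finite_mult_closed_power_card:
  fixes S :: "'c::field set"
  assumes "finite S" and "0 \<notin> S" and closed: "\<And>x y. x \<in> S \<Longrightarrow> y \<in> S \<Longrightarrow> x * y \<in> S" and "x \<in> S"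
  shows "x ^ card S = 1"
proof -
  have x0: "x \<noteq> 0" using assms by auto
  have inj: "inj_on ((*) x) S" using x0 by (auto simp: inj_on_def)
  have "(*) x ` S = S"
    by (rule card_subset_eq) (use assms inj closed card_image in auto)
  then have "\<Prod>S = (\<Prod>y\<in>(*) x ` S. y)" by simp
  also have "\<dots> = (\<Prod>y\<in>S. x * y)" using prod.reindex[OF inj, of id] by (simp add: o_def)
  also have "\<dots> = x ^ card S * \<Prod>S" by (simp add: prod.distrib)
  finally show ?thesis using assms by (auto simp: prod_zero_iff)
qed

lemma gf_simps [simp]: "m > 0 \<Longrightarrow> 0 \<in> gf m" "1 \<in> gf m"
  by (auto simp: gf_def)

lemma gf_mult: "x \<in> gf m \<Longrightarrow> y \<in> gf m \<Longrightarrow> x * y \<in> gf m"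
  by (auto simp: gf_def power_mult_distrib)

lemma gf_inverse: "x \<in> gf m \<Longrightarrow> inverse x \<in> gf m"
  by (auto simp: gf_def power_inverse)

lemma gf_divide: "x \<in> gf m \<Longrightarrow> y \<in> gf m \<Longrightarrow> x / y \<in> gf m"
  by (auto simp: gf_def power_divide)

lemma gf_power: "x \<in> gf m \<Longrightarrow> x ^ i \<in> gf m"
  by (induction i) (auto intro: gf_mult)

lemma gf_iterate: "x \<in> gf m \<Longrightarrow> x ^ (m ^ i) = x"
  by (induction i) (auto simp: gf_def power_mult)

lemma gf_mono: "a dvd b \<Longrightarrow> gf (m ^ a) \<subseteq> gf (m ^ b)"
  using gf_iterate by (auto simp: gf_def power_mult dvd_def)

lemma gf_unit_power: "x \<in> gf m \<Longrightarrow> x \<noteq> 0 \<Longrightarrow> m > 0 \<Longrightarrow> x ^ (m - 1) = 1"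
  by (cases m) (auto simp: gf_def)

lemma subfield_eq_gf:
  assumes "is_subfield S" and "finite S"
  shows "S \<subseteq> gf (card S)"
proof
  fix x assume x: "x \<in> S"
  have "card (S - {0}) = card S - 1" and pos: "card S > 0"
    using assms by (auto simp: is_subfield_def card_gt_0_iff)
  have "x ^ (card S - 1) = 1" if "x \<noteq> 0"
    using finite_mult_closed_power_card[of "S - {0}" x] assms x that \<open>card (S - {0}) = _\<close>
    by (auto simp: is_subfield_def)
  then have "x ^ Suc (card S - 1) = x" if "x \<noteq> 0" using that by simp
  then show "x \<in> gf (card S)"
    using pos by (cases "x = 0") (auto simp: gf_def simp del: power_Suc)
qed

locale prime_power_char =
  fixes q j :: nat and tc :: "'c::alg_closed_field itself"
  assumes prime_char: "normalization_semidom_class.prime CHAR('c)" and q_eq: "q = CHAR('c) ^ j" and j_pos: "j > 0"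
begin

lemma q_gt1: "q > 1"
  using one_less_power[OF prime_gt_1_nat[OF prime_char] j_pos] unfolding q_eq .

lemma q_pos [simp]: "q > 0" using q_gt1 by simp

lemma frob_add: "(x + y :: 'c) ^ (q ^ a) = x ^ (q ^ a) + y ^ (q ^ a)"
  by (rule freshmans_dream'[OF prime_char, of _ "j * a"]) (simp add: q_eq power_mult)

lemma frob_uminus: "(- x :: 'c) ^ (q ^ a) = - (x ^ (q ^ a))"
proof -
  have "x ^ (q ^ a) + (- x) ^ (q ^ a) = 0" using frob_add[of x "-x" a]
    by (simp add: power_0_left q_pos[THEN less_imp_neq, symmetric])
  then show ?thesis by (simp add: add_eq_0_iff)
qed

lemma frob_diff: "(x - y :: 'c) ^ (q ^ a) = x ^ (q ^ a) - y ^ (q ^ a)"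
  using frob_add[of x "- y" a] by (simp add: frob_uminus)

lemma frob_sum: "(\<Sum>i\<in>A. f i :: 'c) ^ (q ^ a) = (\<Sum>i\<in>A. f i ^ (q ^ a))"
  by (rule freshmans_dream_sum'[OF prime_char, of _ "j * a"]) (simp add: q_eq power_mult)

lemma frob_inj: "(x::'c) ^ (q ^ a) = y ^ (q ^ a) \<longleftrightarrow> x = y"
  using frob_diff[of x y a] by auto

lemma gf_add: "(x::'c) \<in> gf (q ^ a) \<Longrightarrow> y \<in> gf (q ^ a) \<Longrightarrow> x + y \<in> gf (q ^ a)"
  by (auto simp: gf_def frob_add)

lemma gf_uminus: "(x::'c) \<in> gf (q ^ a) \<Longrightarrow> - x \<in> gf (q ^ a)"
  by (auto simp: gf_def frob_uminus)

lemma gf_diff: "(x::'c) \<in> gf (q ^ a) \<Longrightarrow> y \<in> gf (q ^ a) \<Longrightarrow> x - y \<in> gf (q ^ a)"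
  by (auto simp: gf_def frob_diff)

lemma gf_sum: "(\<And>i. i \<in> A \<Longrightarrow> f i \<in> gf (q ^ a)) \<Longrightarrow> (\<Sum>i\<in>A. f i :: 'c) \<in> gf (q ^ a)"
  by (induction A rule: infinite_finite_induct) (auto intro: gf_add)

lemma gf_subfield: "is_subfield (gf (q ^ a) :: 'c set)"
  by (auto simp: is_subfield_def gf_inverse gf_mult gf_add gf_uminus)

text \<open>
  The polynomial \<open>X\<^sup>m - X\<close> has derivative \<open>-1\<close> in characteristic \<open>p\<close>, so none of its \<open>m\<close> linear
  factors is repeated.
\<close>

lemma card_gf:
  assumes "a > 0"
  shows "card (gf (q ^ a) :: 'c set) = q ^ a" and "finite (gf (q ^ a) :: 'c set)"
proof -
  define m where "m = q ^ a"
  have m1: "m > 1" using one_less_power[OF q_gt1 assms] by (simp add: m_def)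
  define p :: "'c poly" where "p = monom 1 m - monom 1 1"
  have deg: "degree p = m" unfolding p_def
    by (rule antisym, rule degree_diff_le) (use m1 in \<open>auto intro!: le_degree simp: degree_monom_eq\<close>)
  then have p0: "p \<noteq> 0" using m1 by auto
  have roots: "gf m = {x::'c. poly p x = 0}"
    by (auto simp: gf_def p_def poly_monom)
  have char0: "of_nat m = (0::'c)"
    using assms j_pos by (simp add: m_def q_eq of_nat_eq_0_iff_char_dvd)
  have der: "pderiv p = [:-1:]"
    unfolding p_def pderiv_diff pderiv_monom using char0 by (simp add: monom_0)
  obtain A where A: "size A = degree p" "p = smult (lead_coeff p) (\<Prod>x\<in>#A. [:-x, 1:])"
    using alg_closed_imp_factorization[OF p0] by blast
  have set_A: "set_mset A = gf m"
  proof -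
    have "poly p x = lead_coeff p * (\<Prod>y\<in>#A. x - y)" for x
      by (subst A(2)) (simp add: poly_prod_mset image_mset.compositionality o_def)
    then show ?thesis using p0 by (auto simp: roots prod_mset_zero_iff)
  qed
  have simple: "count A x \<le> 1" for x
  proof (rule ccontr)
    assume "\<not> count A x \<le> 1"
    then have c: "count A x \<ge> 2" by simp
    then obtain B where "A = add_mset x B"
      by (metis One_nat_def count_greater_zero_iff le_zero_eq mset_add not_gr_zero numeral_2_eq_2 nat.simps(3))
    moreover then have "x \<in># B" using c by (auto simp flip: count_greater_zero_iff)
    then obtain D where "B = add_mset x D" by (meson multi_member_split)
    ultimately have "A = add_mset x (add_mset x D)" by simp
    then have "p = [:-x,1:] * ([:-x,1:] * smult (lead_coeff p) (\<Prod>x\<in>#D. [:-x, 1:]))"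
      by (subst A(2)) (simp add: mult_ac)
    then obtain h where "p = [:-x,1:] * ([:-x,1:] * h)" by blast
    then have "poly (pderiv p) x = 0"
      by (simp add: pderiv_mult del: mult_pCons_left)
    then show False by (simp add: der)
  qed
  have "A = mset_set (gf m)"
  proof (rule multiset_eqI)
    fix x
    show "count A x = count (mset_set (gf m)) x"
      using simple[of x] by (cases "x \<in># A") (auto simp: le_Suc_eq count_eq_zero_iff simp flip: set_A)
  qed
  moreover have "finite (gf m :: 'c set)" using set_A by (metis finite_set_mset)
  ultimately have "card (gf m :: 'c set) = m" using A(1) deg by simp
  then show "card (gf (q ^ a) :: 'c set) = q ^ a" and "finite (gf (q ^ a) :: 'c set)"
    using \<open>finite (gf m :: 'c set)\<close> by (auto simp: m_def)
qed

text \<open>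
  If \<open>a * u = b * v + gcd a b\<close>, the iterates number \<open>a * u\<close> and \<open>b * v\<close> of the map \<open>x \<mapsto> x\<^sup>q\<close> both fix \<open>x\<close>,
  and therefore so does iterate number \<open>gcd a b\<close>.
\<close>

lemma gf_inter:
  assumes "a > 0" "x \<in> gf (q ^ a)" "(x::'c) \<in> gf (q ^ b)"
  shows "x \<in> gf (q ^ gcd a b)"
proof -
  obtain u v where uv: "a * u = b * v + gcd a b"
    using bezout_nat[of a b] assms(1) by auto
  have "x = x ^ (q ^ a) ^ u" using gf_iterate[OF assms(2)] by simp
  also have "\<dots> = x ^ (q ^ (b * v + gcd a b))" by (simp flip: power_mult add: uv)
  also have "\<dots> = (x ^ ((q ^ b) ^ v)) ^ (q ^ gcd a b)" by (simp add: power_add power_mult)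
  also have "\<dots> = x ^ (q ^ gcd a b)" using gf_iterate[OF assms(3)] by simp
  finally show ?thesis by (simp add: gf_def)
qed

lemma gf_generator:
  assumes "a > 0"
  obtains b :: 'c where "b \<in> gf (q ^ a)" "b \<noteq> 0" "\<And>x. x \<in> gf (q ^ a) \<Longrightarrow> x \<noteq> 0 \<Longrightarrow> \<exists>i. x = b ^ i"
proof -
  define R :: "'c ring" where
    "R = \<lparr>carrier = gf (q ^ a), monoid.mult = (*), one = 1, ring.zero = 0, add = (+)\<rparr>"
  have inv: "\<exists>y\<in>gf (q ^ a). x * y = 1" if "x \<in> gf (q ^ a)" "x \<noteq> 0" for x :: 'c
    using that by (intro bexI[of _ "inverse x"]) (auto intro: gf_inverse)
  interpret R: field R
    unfolding R_def using inv
    by unfold_locales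
       (auto simp: Units_def algebra_simps gf_mult gf_add intro: bexI[of _ "- x" for x] gf_uminus)
  have "\<exists>a \<in> carrier (Multiplicative_Group.mult_of R). carrier (Multiplicative_Group.mult_of R)
    = {a[^]\<^bsub>R\<^esub>i | i::nat. i \<in> UNIV}"
    by (rule R.finite_field_mult_group_has_gen) (simp add: R_def card_gf assms)
  then obtain b where b: "b \<in> gf (q ^ a) - {0}" "gf (q ^ a) - {0} = {b[^]\<^bsub>R\<^esub>i | i::nat. i \<in> UNIV}"
    by (auto simp: R_def)
  have "b[^]\<^bsub>R\<^esub>i = b ^ i" for i :: nat
    by (induction i) (auto simp: R_def nat_pow_def)
  with b show ?thesis by (intro that[of b]) auto
qed

end

section \<open>The tower of fields over GF(q)\<close>

lemma card_vec_all_in: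
  fixes S :: "'a set"
  assumes "finite S"
  shows "card {v :: 'a ^ 'n::finite. \<forall>i. v $ i \<in> S} = card S ^ CARD('n)"
proof -
  have "bij_betw vec_lambda (PiE (UNIV :: 'n set) (\<lambda>_. S)) {v :: 'a ^ 'n. \<forall>i. v $ i \<in> S}"
    by (rule bij_betw_byWitness[where f' = vec_nth]) (auto simp: PiE_def Pi_def)
  then have "card {v :: 'a ^ 'n. \<forall>i. v $ i \<in> S} = card (PiE (UNIV :: 'n set) (\<lambda>_. S))"
    using bij_betw_same_card by metis
  then show ?thesis by (simp add: card_PiE)
qed

text \<open>
  Write \<open>Q = q ^ k\<close> and \<open>F = GF(Q)\<close>; the type \<^typ>\<open>'a\<close> is \<open>F\<close>, and it is embedded by \<^const>\<open>to_ac\<close> into its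
  algebraic closure. The points under consideration are those of the projective space of
  \<open>V = F\<^sup>N\<close>. The last two parameters only carry the types.
\<close>

locale singer_tower = prime_power_char q j "TYPE('a::{field,finite} alg_closure)" for q j +
  fixes k N :: nat and ta :: "'a::{field,finite} itself" and tn :: "'n::finite itself"
  assumes k_gt1: "k > 1" and N_gt1: "N > 1" and coprime_kn: "gcd k N = 1"
    and card_base: "CARD('a) = q ^ k" and card_index: "CARD('n) = N"
begin

text \<open>
  The extension \<open>E\<close> of \<open>GF(q)\<close> of degree \<open>N\<close> and the extension \<open>L\<close> of \<open>F\<close> of degree \<open>N\<close> are the two
  Singer fields. Since \<open>k\<close> and \<open>N\<close> are coprime, \<open>L\<close> is the compositum of \<open>E\<close> and \<open>F\<close>, and \<open>E\<close> meets \<open>F\<close> in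
  \<open>GF(q)\<close>. The group \<open>G\<close> is the product of the multiplicative groups of \<open>F\<close> and \<open>E\<close>; once \<open>V\<close> is
  identified with \<open>L\<close>, its cosets are the classes of vectors whose points form one part.
\<close>

definition E :: "'a alg_closure set" where "E = gf (q ^ N)"
definition L :: "'a alg_closure set" where "L = gf (q ^ (k * N))"
definition G :: "'a alg_closure set" where
  "G = {to_ac a * e | a e. a \<noteq> 0 \<and> e \<in> E \<and> e \<noteq> 0}"

lemma range_to_ac: "range (to_ac :: 'a \<Rightarrow> _) = gf (q ^ k)"
proof -
  have card: "card (range (to_ac :: 'a \<Rightarrow> _)) = q ^ k"
    using card_image[of "to_ac :: 'a \<Rightarrow> _" UNIV, OF inj_to_ac] card_base by simp
  have "is_subfield (range (to_ac :: 'a \<Rightarrow> _))"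
    unfolding is_subfield_def
    by (auto simp flip: to_ac_add to_ac_mult to_ac_minus to_ac_inverse)
  then have "range (to_ac :: 'a \<Rightarrow> _) \<subseteq> gf (q ^ k)"
    using subfield_eq_gf[of "range (to_ac :: 'a \<Rightarrow> _)"] card by simp
  then show ?thesis
    using card card_gf[of k] k_gt1 by (intro card_subset_eq) auto
qed

lemma to_ac_in_gf [simp]: "to_ac (a :: 'a) \<in> gf (q ^ k)"
  using range_to_ac by blast

lemma gf_obtain_to_ac: "x \<in> gf (q ^ k) \<Longrightarrow> \<exists>a :: 'a. x = to_ac a"
  using range_to_ac by blast

lemma F_sub_L: "gf (q ^ k) \<subseteq> L" and E_sub_L: "E \<subseteq> L"
  unfolding E_def L_def by (intro gf_mono; simp)+

lemma to_ac_L [simp]: "to_ac (a :: 'a) \<in> L"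
  using F_sub_L to_ac_in_gf by blast

lemma L_closed:
  "x \<in> L \<Longrightarrow> y \<in> L \<Longrightarrow> x + y \<in> L" "x \<in> L \<Longrightarrow> y \<in> L \<Longrightarrow> x * y \<in> L"
  "x \<in> L \<Longrightarrow> y \<in> L \<Longrightarrow> x / y \<in> L" "x \<in> L \<Longrightarrow> y \<in> L \<Longrightarrow> x - y \<in> L"
  "x \<in> L \<Longrightarrow> x ^ i \<in> L" "0 \<in> L" "1 \<in> L"
  by (simp_all add: L_def gf_add gf_mult gf_divide gf_diff gf_power)

lemma E_closed:
  "x \<in> E \<Longrightarrow> y \<in> E \<Longrightarrow> x + y \<in> E" "x \<in> E \<Longrightarrow> y \<in> E \<Longrightarrow> x * y \<in> E"
  "x \<in> E \<Longrightarrow> y \<in> E \<Longrightarrow> x / y \<in> E" "x \<in> E \<Longrightarrow> y \<in> E \<Longrightarrow> x - y \<in> E"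
  "x \<in> E \<Longrightarrow> x ^ i \<in> E" "0 \<in> E" "1 \<in> E" "x \<in> E \<Longrightarrow> - x \<in> E"
  by (simp_all add: E_def gf_add gf_mult gf_divide gf_diff gf_power gf_uminus)

lemma card_E: "card E = q ^ N" "finite E"
  unfolding E_def using card_gf[of N] N_gt1 by simp_all

lemma card_L: "card L = q ^ (k * N)" "finite L"
  unfolding L_def using card_gf[of "k * N"] k_gt1 N_gt1 by simp_all

lemma E_inter_F: "x \<in> E \<Longrightarrow> x \<in> gf (q ^ k) \<Longrightarrow> x \<in> gf q"
  using gf_inter[of k x N] k_gt1 coprime_kn by (simp add: E_def)

lemma gf_q_sub: "gf q \<subseteq> E" "gf q \<subseteq> (gf (q ^ k) :: 'a alg_closure set)"
  unfolding E_def using gf_mono[of 1 N q] gf_mono[of 1 k q] by auto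

lemma G_I: "a \<noteq> 0 \<Longrightarrow> e \<in> E \<Longrightarrow> e \<noteq> 0 \<Longrightarrow> to_ac a * e \<in> G"
  unfolding G_def by blast

lemma G_nonzero: "0 \<notin> G"
  by (auto simp: G_def)

lemma G_mult: "x \<in> G \<Longrightarrow> y \<in> G \<Longrightarrow> x * y \<in> G"
proof -
  assume "x \<in> G" "y \<in> G"
  then obtain a e b f where *: "x = to_ac a * e" "y = to_ac b * f" "a \<noteq> 0" "b \<noteq> 0"
    "e \<in> E" "e \<noteq> 0" "f \<in> E" "f \<noteq> 0" unfolding G_def by blast
  have "x * y = to_ac (a * b) * (e * f)" by (simp add: *)
  then show ?thesis using G_I[of "a * b" "e * f"] *(3-) by (simp add: E_closed)
qed

lemma G_inverse: "x \<in> G \<Longrightarrow> inverse x \<in> G"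
proof -
  assume "x \<in> G"
  then obtain a e where *: "x = to_ac a * e" "a \<noteq> 0" "e \<in> E" "e \<noteq> 0" unfolding G_def by blast
  have "inverse x = to_ac (inverse a) * (1 / e)" by (simp add: * field_simps)
  then show ?thesis using G_I[of "inverse a" "1 / e"] * E_closed(3)[OF E_closed(7), of e] by simp
qed

lemma G_divide: "x \<in> G \<Longrightarrow> y \<in> G \<Longrightarrow> x / y \<in> G"
  by (simp add: divide_inverse G_mult G_inverse)

lemma to_ac_G: "a \<noteq> 0 \<Longrightarrow> to_ac (a :: 'a) \<in> G"
  using G_I[of a 1] by (simp add: E_closed)

lemma E_sub_G: "e \<in> E \<Longrightarrow> e \<noteq> 0 \<Longrightarrow> e \<in> G"
  using G_I[of 1 e] by simp

lemma G_sub_L: "G \<subseteq> L"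
  using E_sub_L by (auto simp: G_def intro!: L_closed)

text \<open>
  If \<open>w = a e\<close> and \<open>w + 1 = a' e'\<close> are both products of an element of \<open>F\<close> and one of \<open>E\<close>, then \<open>w\<close> is
  already in \<open>E\<close>, unless it lies in \<open>F\<close>. The power map with exponent \<open>q ^ N\<close> fixes \<open>E\<close> pointwise and
  generates the automorphisms of \<open>F\<close> over \<open>GF(q)\<close>. Applying it to \<open>a e + 1 = a' e'\<close> and eliminating \<open>e'\<close>
  leaves a linear equation for \<open>e\<close> over \<open>F\<close>; as \<open>e\<close> is not in \<open>F\<close>, its coefficients vanish, and \<open>a\<close> is
  fixed by the power map. Geometrically: a \<open>GF(q)\<close>-lattice is determined, up to a scalar, by the
  subgeometry that it spans.
\<close>

lemma pure_product_in_E: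
  assumes "w \<in> G" "w + 1 \<in> G" and rat: "w \<in> gf (q ^ k) \<Longrightarrow> w \<in> E"
  shows "w \<in> E"
proof -
  let ?N = "q ^ N"
  obtain a e where w: "w = to_ac a * e" "e \<in> E" "e \<noteq> 0" "a \<noteq> 0" using assms(1) by (auto simp: G_def)
  obtain a' e' where w': "w + 1 = to_ac a' * e'" "e' \<in> E" "a' \<noteq> 0" using assms(2) by (auto simp: G_def)
  define b where "b = to_ac a ^ ?N"
  define b' where "b' = to_ac a' ^ ?N"
  have bF: "b \<in> gf (q ^ k)" "b' \<in> gf (q ^ k)"
    by (simp_all add: b_def b'_def gf_power)
  have b0: "b' \<noteq> 0" using w'(3) by (simp add: b'_def)
  have fix_e: "e ^ ?N = e" "e' ^ ?N = e'" using w w' by (auto simp: E_def gf_def)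
  have eq1: "to_ac a * e + 1 = to_ac a' * e'" using w w' by simp
  from arg_cong[OF this, of "\<lambda>x. x ^ ?N"]
  have eq2: "b * e + 1 = b' * e'"
    by (simp only: frob_add power_mult_distrib fix_e b_def b'_def power_one)
  have "b' * (to_ac a * e + 1) = to_ac a' * (b * e + 1)"
    unfolding eq1 eq2 by (simp add: mult_ac)
  then have lin: "(b' * to_ac a - to_ac a' * b) * e = to_ac a' - b'"
    by (simp add: algebra_simps)
  show ?thesis
  proof (cases "e \<in> gf (q ^ k)")
    case True
    then show ?thesis using rat w by (simp add: gf_mult)
  next
    case False
    have "b' * to_ac a - to_ac a' * b = 0"
    proof (rule ccontr)
      assume "b' * to_ac a - to_ac a' * b \<noteq> 0"
      then have "e = (to_ac a' - b') / (b' * to_ac a - to_ac a' * b)"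
        using lin by (simp add: field_simps)
      then show False using False bF by (simp add: gf_diff gf_mult gf_divide)
    qed
    with lin b0 have "b = to_ac a" by simp
    then have "to_ac a \<in> E" by (simp add: b_def E_def gf_def)
    then show ?thesis using w by (simp add: E_closed)
  qed
qed

text \<open>
  Multiplication by this generator of the multiplicative group of \<open>E\<close> is the Singer cycle.
\<close>

definition beta :: "'a alg_closure" where
  "beta = (SOME b. b \<in> E \<and> b \<noteq> 0 \<and> (\<forall>x\<in>E. x \<noteq> 0 \<longrightarrow> (\<exists>i. x = b ^ i)))"

lemma beta: "beta \<in> E" "beta \<noteq> 0" "x \<in> E \<Longrightarrow> x \<noteq> 0 \<Longrightarrow> \<exists>i. x = beta ^ i"
proof -
  have "\<exists>b. b \<in> E \<and> b \<noteq> 0 \<and> (\<forall>x\<in>E. x \<noteq> 0 \<longrightarrow> (\<exists>i. x = b ^ i))"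
    using gf_generator[of N] unfolding E_def using N_gt1 by (metis less_trans zero_less_one)
  then show "beta \<in> E" "beta \<noteq> 0" "x \<in> E \<Longrightarrow> x \<noteq> 0 \<Longrightarrow> \<exists>i. x = beta ^ i"
    using someI_ex[of "\<lambda>b. b \<in> E \<and> b \<noteq> 0 \<and> (\<forall>x\<in>E. x \<noteq> 0 \<longrightarrow> (\<exists>i. x = b ^ i))"]
    unfolding beta_def by blast+
qed

text \<open>
  The degree of \<^term>\<open>beta\<close> over \<open>F\<close> is still \<open>N\<close>. A coincidence between conjugates would place \<^term>\<open>beta\<close>,
  and with it all of \<open>E\<close>, in \<open>GF(q ^ (k * d))\<close> for some \<open>0 < d < N\<close>, hence in \<open>GF(q ^ gcd N d)\<close> by
  coprimality, which is too small.
\<close>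

lemma beta_conjugates_distinct: "inj_on (\<lambda>i. beta ^ (q ^ (k * i))) {..<N}"
proof -
  have False if "i < i'" "i' < N" "beta ^ (q ^ (k * i)) = beta ^ (q ^ (k * i'))" for i i'
  proof -
    define d where "d = i' - i"
    have d: "d > 0" "d < N" "i' = d + i" using that by (auto simp: d_def)
    have "(beta ^ (q ^ (k * d))) ^ (q ^ (k * i)) = beta ^ (q ^ (k * i))"
      using that(3) d by (simp add: algebra_simps flip: power_mult power_add)
    then have fixed: "beta ^ (q ^ (k * d)) = beta" by (simp only: frob_inj)
    have "E \<subseteq> gf (q ^ d)"
    proof
      fix x assume x: "x \<in> E"
      have "x \<in> gf (q ^ (k * d))"
      proof (cases "x = 0")
        case False
        then obtain i where "x = beta ^ i" using beta(3) x by blast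
        moreover have "beta \<in> gf (q ^ (k * d))" using fixed by (simp add: gf_def)
        ultimately show ?thesis by (simp add: gf_power)
      qed simp
      then have "x \<in> gf (q ^ gcd N (k * d))"
        using gf_inter[of N x "k * d"] x N_gt1 by (simp add: E_def)
      moreover have "gcd N (k * d) = gcd N d"
        using coprime_kn by (metis coprime_iff_gcd_eq_1 gcd.commute gcd_mult_left_left_cancel)
      ultimately show "x \<in> gf (q ^ d)" using gf_mono[of "gcd N d" d q] by auto
    qed
    then have "q ^ N \<le> q ^ d"
      using card_mono[of "gf (q ^ d)" E] card_gf[of d] card_E d by auto
    then show False using d q_gt1 power_le_imp_le_exp[of q N d] by auto
  qed
  then show ?thesis unfolding inj_on_def
    by (metis lessThan_iff linorder_neqE_nat)
qed

lemma conjugate_of_beta: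
  assumes "degree p \<le> N" "p \<noteq> 0" and conj: "\<And>i. poly p (beta ^ (q ^ (k * i))) = 0" and "poly p y = 0"
  shows "\<exists>i<N. y = beta ^ (q ^ (k * i))"
proof (rule ccontr)
  assume neg: "\<not> ?thesis"
  let ?C = "(\<lambda>i. beta ^ (q ^ (k * i))) ` {..<N}"
  have "card (insert y ?C) = N + 1"
    using neg card_image[OF beta_conjugates_distinct] by (subst card_insert_disjoint) auto
  moreover have "card (insert y ?C) \<le> card {x. poly p x = 0}"
    by (rule card_mono) (use assms poly_roots_finite in auto)
  ultimately show False using card_poly_roots_bound[of p] assms by simp
qed

definition idx :: "'n \<Rightarrow> nat" where
  "idx = (SOME f. bij_betw f UNIV {..<N})"

lemma bij_idx: "bij_betw idx UNIV {..<N}"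
proof -
  have "\<exists>f. bij_betw f (UNIV :: 'n set) {..<N}"
    by (rule finite_same_card_bij) (simp_all add: card_index)
  then show ?thesis unfolding idx_def by (rule someI_ex)
qed

text \<open>
  The powers of \<^term>\<open>beta\<close> with exponent below \<open>N\<close> form a basis of \<open>E\<close> over \<open>GF(q)\<close> and of \<open>L\<close> over \<open>F\<close>. This
  gives one \<open>F\<close>-linear identification of \<open>V\<close> with \<open>L\<close>, under which the vectors with all coordinates
  in \<open>GF(q)\<close> correspond to \<open>E\<close>.
\<close>

definition zeta0 :: "'a ^ 'n \<Rightarrow> 'a alg_closure" where
  "zeta0 v = (\<Sum>i\<in>UNIV. to_ac (v $ i) * beta ^ idx i)"

definition coord_poly :: "'a ^ 'n \<Rightarrow> 'a alg_closure poly" where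
  "coord_poly v = (\<Sum>i\<in>UNIV. monom (to_ac (v $ i)) (idx i))"

lemma poly_coord_poly: "poly (coord_poly v) x = (\<Sum>i\<in>UNIV. to_ac (v $ i) * x ^ idx i)"
  by (simp add: coord_poly_def poly_sum poly_monom)

lemma poly_coord_poly_conj: "poly (coord_poly v) (x ^ (q ^ (k * i))) = (poly (coord_poly v) x) ^ (q ^ (k * i))"
proof -
  have "to_ac a ^ (q ^ (k * i)) = to_ac a" for a :: 'a
    using gf_iterate[OF to_ac_in_gf, of a i] by (simp add: power_mult)
  then show ?thesis
    by (simp add: poly_coord_poly frob_sum power_mult_distrib mult.commute flip: power_mult)
qed

lemma coeff_coord_poly: "coeff (coord_poly v) (idx i) = to_ac (v $ i)"
proof -
  have "coeff (coord_poly v) (idx i) = (\<Sum>l\<in>UNIV. if l = i then to_ac (v $ l) else 0)"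
    using bij_betw_imp_inj_on[OF bij_idx] by (simp add: coord_poly_def coeff_sum inj_eq)
  then show ?thesis by simp
qed

lemma degree_coord_poly: "degree (coord_poly v) < N"
proof -
  have "degree (monom (to_ac (v $ i)) (idx i)) < N" for i
    using degree_monom_le[of "to_ac (v $ i)" "idx i"] bij_betwE[OF bij_idx]
    by (metis UNIV_I lessThan_iff order_le_less_trans)
  then show ?thesis unfolding coord_poly_def
    using N_gt1 by (intro degree_sum_less) auto
qed

lemma zeta0_poly: "zeta0 v = poly (coord_poly v) beta"
  by (simp add: zeta0_def poly_coord_poly)

lemma zeta0_add: "zeta0 (x + y) = zeta0 x + zeta0 y"
  by (simp add: zeta0_def sum.distrib algebra_simps)

lemma zeta0_scale: "zeta0 (a *s x) = to_ac a * zeta0 x"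
  by (simp add: zeta0_def sum_distrib_left mult_ac)

text \<open>
  A vector in the kernel gives a polynomial over \<open>F\<close> of degree below \<open>N\<close> that vanishes at the \<open>N\<close>
  conjugates of \<^term>\<open>beta\<close>.
\<close>

lemma zeta0_eq_0: "zeta0 v = 0 \<longleftrightarrow> v = 0"
proof
  assume "zeta0 v = 0"
  then have roots: "poly (coord_poly v) (beta ^ (q ^ (k * i))) = 0" for i
    by (simp add: poly_coord_poly_conj zeta0_poly zero_power)
  have "coord_poly v = 0"
  proof (rule ccontr)
    assume nz: "coord_poly v \<noteq> 0"
    have "card ((\<lambda>i. beta ^ (q ^ (k * i))) ` {..<N}) \<le> card {x. poly (coord_poly v) x = 0}"
      by (rule card_mono) (use roots nz poly_roots_finite in auto)
    then show False
      using card_poly_roots_bound[OF nz] degree_coord_poly[of v]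
      by (simp add: card_image[OF beta_conjugates_distinct])
  qed
  then have "to_ac (v $ i) = 0" for i using coeff_coord_poly[of v i] by simp
  then show "v = 0" by (simp add: vec_eq_iff)
qed (simp add: zeta0_def)

lemma inj_zeta0: "inj zeta0"
proof (rule injI)
  fix x y assume "zeta0 x = zeta0 y"
  then have "zeta0 (x + (-1) *s y) = 0" by (simp only: zeta0_add zeta0_scale) simp
  then show "x = y" by (simp add: zeta0_eq_0)
qed

lemma bij_zeta0: "bij_betw zeta0 UNIV L"
proof -
  have "zeta0 v \<in> L" for v
    unfolding zeta0_def L_def
    by (rule gf_sum) (use E_sub_L beta(1) to_ac_L in \<open>auto simp: L_def intro!: gf_mult gf_power\<close>)
  then have "range zeta0 = L"
    using card_image[OF inj_zeta0] card_vec_all_in[of "UNIV :: 'a set", where 'n = 'n] card_L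
    by (intro card_subset_eq) (auto simp: card_base card_index simp flip: power_mult)
  then show ?thesis using inj_zeta0 by (simp add: bij_betw_def)
qed

definition Fq :: "'a set" where "Fq = {a. a ^ q = a}"

lemma Fq_iff: "a \<in> Fq \<longleftrightarrow> to_ac a \<in> gf q"
  by (simp add: Fq_def gf_def flip: to_ac_power)

lemma to_ac_Fq: "to_ac ` Fq = gf q"
proof -
  have "x \<in> to_ac ` Fq" if "x \<in> gf q" for x
    using that gf_q_sub(2) gf_obtain_to_ac[of x] by (metis Fq_iff image_eqI subsetD)
  then show ?thesis by (auto simp: Fq_iff)
qed

lemma card_Fq: "card Fq = q"
  using card_image[of to_ac Fq] card_gf[of 1] inj_to_ac by (simp add: to_ac_Fq inj_on_def)

lemma zeta0_lattice: "zeta0 ` {v :: 'a ^ 'n. \<forall>i. v $ i \<in> Fq} = E"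
proof (rule card_subset_eq)
  show "zeta0 ` {v :: 'a ^ 'n. \<forall>i. v $ i \<in> Fq} \<subseteq> E"
  proof clarify
    fix v :: "'a ^ 'n" assume v: "\<forall>i. v $ i \<in> Fq"
    show "zeta0 v \<in> E"
      unfolding zeta0_def E_def
      by (rule gf_sum) (use v gf_q_sub(1) beta(1) in \<open>auto simp: E_def Fq_iff intro!: gf_mult gf_power\<close>)
  qed
  show "card (zeta0 ` {v :: 'a ^ 'n. \<forall>i. v $ i \<in> Fq}) = card E"
    using card_image[OF inj_on_subset[OF inj_zeta0], of "{v :: 'a ^ 'n. \<forall>i. v $ i \<in> Fq}"]
    by (simp add: card_vec_all_in card_Fq card_index card_E)
qed (simp add: card_E)

section \<open>Linear maps of L that preserve the cosets of G\<close>


lemma frob_linear: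
  "(to_ac (a :: 'a)) ^ (q ^ (k * i)) = to_ac a"
  using gf_iterate[OF to_ac_in_gf, of a i] by (simp add: power_mult)

lemma G_frob: "x \<in> G \<Longrightarrow> x ^ (q ^ (k * i)) \<in> G"
  by (auto simp: G_def power_mult_distrib frob_linear) (metis E_closed(5) power_not_zero)

lemma L_obtain_coords: "x \<in> L \<Longrightarrow> \<exists>v. x = zeta0 v"
  using bij_zeta0 by (auto simp: bij_betw_def)

text \<open>
  The quotients \<open>psi (e * x) / psi x\<close> with \<open>e\<close> in \<open>E\<close> form a \<open>GF(q)\<close>-space that contains \<open>1\<close>, consists of
  pure products and meets \<open>F\<close> only in \<open>GF(q)\<close>. Hence the preceding lemma on pure products applies to
  each of them.
\<close>

lemma ratio_in_E:
  fixes psi :: "'a alg_closure \<Rightarrow> 'a alg_closure"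
  assumes add: "\<And>x y. x \<in> L \<Longrightarrow> y \<in> L \<Longrightarrow> psi (x + y) = psi x + psi y"
    and scale: "\<And>a x. x \<in> L \<Longrightarrow> psi (to_ac a * x) = to_ac a * psi x"
    and nz: "\<And>x. x \<in> L \<Longrightarrow> psi x = 0 \<Longrightarrow> x = 0"
    and x: "x \<in> L" "x \<noteq> 0"
    and pres: "\<And>e. e \<in> E \<Longrightarrow> e \<noteq> 0 \<Longrightarrow> psi (e * x) / psi x \<in> G"
    and e: "e \<in> E"
  shows "psi (e * x) / psi x \<in> E"
proof -
  have diff: "psi (y - z) = psi y - psi z" if "y \<in> L" "z \<in> L" for y z
    using add[of "y - z" z] that by (simp add: L_closed)
  have psi0: "psi 0 = 0" using diff[of 0 0] by (simp add: L_closed)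
  have inj: "y = z" if "y \<in> L" "z \<in> L" "psi y = psi z" for y z
    using diff[OF that(1,2)] nz[of "y - z"] that by (simp add: L_closed)
  have cx: "psi x \<noteq> 0" using nz x by blast
  show ?thesis
  proof (cases "e = 0 \<or> e = - 1")
    case True
    have "psi (- 1 * x) = - psi x" using diff[of 0 x] psi0 x by (simp add: L_closed)
    then show ?thesis using True psi0 cx by (auto simp: E_closed)
  next
    case False
    then have e1: "e + 1 \<noteq> 0" by (metis add_eq_0_iff2)
    have ex: "e * x \<in> L" using x e E_sub_L by (auto intro: L_closed)
    show ?thesis
    proof (rule pure_product_in_E)
      show "psi (e * x) / psi x \<in> G"
        by (rule pres) (use e False in auto)
      have "psi ((e + 1) * x) / psi x \<in> G"
        by (rule pres) (use e e1 in \<open>auto simp: E_closed\<close>)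
      then show "psi (e * x) / psi x + 1 \<in> G"
        using add[OF ex x(1)] cx by (simp add: algebra_simps add_divide_distrib)
      assume "psi (e * x) / psi x \<in> gf (q ^ k)"
      then obtain a where a: "psi (e * x) / psi x = to_ac a" using gf_obtain_to_ac by blast
      then have "psi (e * x) = psi (to_ac a * x)" using scale[OF x(1)] cx by (simp add: field_simps)
      then have "e * x = to_ac a * x"
        using inj[OF ex, of "to_ac a * x"] x(1) by (simp only: L_closed to_ac_L)
      then show "psi (e * x) / psi x \<in> E" using e x a by simp
    qed
  qed
qed

text \<open>
  This is the reason why different Singer fields determine different partitions. After scaling,
  \<open>chi 1 = 1\<close>. By the previous lemma \<open>chi (e * x)\<close> is a multiple of \<open>chi x\<close> by an element of \<open>E\<close>, for every
  \<open>e\<close> in \<open>E\<close>. Additivity forces this multiplier to be the same for \<open>x\<close>, for \<open>1\<close> and for \<open>x + 1\<close> whenever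
  \<open>chi x\<close> and \<open>1\<close> are independent over \<open>E\<close>; because \<open>k > 1\<close>, there are enough such elements to conclude
  that it is always \<open>chi e\<close>. Thus \<open>chi\<close> is multiplicative, so it maps \<^term>\<open>beta\<close> to one of its conjugates
  over \<open>F\<close> and is an automorphism of \<open>L\<close> over \<open>F\<close>.
\<close>

lemma partition_preserving_semilinear:
  fixes psi :: "'a alg_closure \<Rightarrow> 'a alg_closure"
  assumes add: "\<And>x y. x \<in> L \<Longrightarrow> y \<in> L \<Longrightarrow> psi (x + y) = psi x + psi y"
    and scale: "\<And>a x. x \<in> L \<Longrightarrow> psi (to_ac a * x) = to_ac a * psi x"
    and mapsto: "\<And>x. x \<in> L \<Longrightarrow> psi x \<in> L"
    and nz: "\<And>x. x \<in> L \<Longrightarrow> psi x = 0 \<Longrightarrow> x = 0"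
    and pres: "\<And>x y. x \<in> L \<Longrightarrow> y \<in> L \<Longrightarrow> x \<noteq> 0 \<Longrightarrow> y / x \<in> G \<Longrightarrow> psi y / psi x \<in> G"
  shows "\<exists>c i. c \<in> L \<and> c \<noteq> 0 \<and> i < N \<and> (\<forall>x\<in>L. psi x = c * x ^ (q ^ (k * i)))"
proof -
  define c where "c = psi 1"
  define chi where "chi x = psi x / c" for x
  have c: "c \<in> L" "c \<noteq> 0" using mapsto[of 1] nz[of 1] by (auto simp: c_def L_closed)
  have chi1: "chi 1 = 1" using c by (simp add: chi_def c_def)
  have chi_add: "chi (x + y) = chi x + chi y" if "x \<in> L" "y \<in> L" for x y
    using add that by (simp add: chi_def add_divide_distrib)
  have chi_scale: "chi (to_ac a * x) = to_ac a * chi x" if "x \<in> L" for a x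
    using scale that by (simp add: chi_def)
  have chi_nz: "x = 0" if "x \<in> L" "chi x = 0" for x using nz[of x] that c by (simp add: chi_def)
  have chi_diff: "chi (x - y) = chi x - chi y" if "x \<in> L" "y \<in> L" for x y
    using chi_add[of "x - y" y] that by (simp add: L_closed)
  have chi_inj: "x = y" if "x \<in> L" "y \<in> L" "chi x = chi y" for x y
    using chi_diff[OF that(1,2)] chi_nz[of "x - y"] that by (simp add: L_closed)
  have chi0: "chi 0 = 0" using chi_diff[of 0 0] by (simp add: L_closed)
  have EL: "e \<in> L" if "e \<in> E" for e using that E_sub_L by blast
  have chi_pres: "chi y / chi x \<in> G" if "x \<in> L" "y \<in> L" "x \<noteq> 0" "y / x \<in> G" for x y
    using pres[OF that] c by (simp add: chi_def)
  have ratio: "chi (e * x) / chi x \<in> E" if x: "x \<in> L" "x \<noteq> 0" and e: "e \<in> E" for e x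
    by (rule ratio_in_E[OF chi_add chi_scale chi_nz x _ e])
       (use x chi_pres EL E_sub_G in \<open>auto simp: L_closed\<close>)
  \<comment> \<open>The field \<open>E\<close> is smaller than \<open>L\<close> because \<open>k > 1\<close>, so \<open>chi\<close> takes a value outside \<open>E\<close>.\<close>
  obtain z where z: "z \<in> L" "chi z \<notin> E"
  proof -
    have "card L = card (chi ` L)" using chi_inj by (intro card_image[symmetric]) (auto simp: inj_on_def)
    moreover have "q ^ N < q ^ (k * N)"
      using k_gt1 N_gt1 q_gt1 by (intro power_strict_increasing) auto
    ultimately have "\<not> chi ` L \<subseteq> E"
      using card_mono[of E "chi ` L"] card_E card_L by auto
    then show ?thesis using that by blast
  qed
  \<comment> \<open>The generic case, in which \<open>chi x\<close> and \<open>1\<close> are independent over \<open>E\<close>.\<close>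
  have off: "chi (e * x) = chi e * chi x" if x: "x \<in> L" "chi x \<notin> E" and e: "e \<in> E" for e x
  proof -
    have x0: "x \<noteq> 0" "x + 1 \<noteq> 0" using x chi0 chi1 chi_add[of x 1]
      by (auto simp: E_closed L_closed add_eq_0_iff2)
    have x1: "x + 1 \<in> L" using x by (simp add: L_closed)
    define t where "t = chi (e * x) / chi x"
    define t' where "t' = chi (e * (x + 1)) / chi (x + 1)"
    have tE: "t \<in> E" "t' \<in> E" "chi e \<in> E"
      using ratio[OF x(1) x0(1) e] ratio[OF x1 x0(2) e] ratio[of 1 e] e chi1
      by (auto simp: t_def t'_def L_closed)
    have "t * chi x + chi e = t' * (chi x + 1)"
    proof -
      have "chi (e * (x + 1)) = chi (e * x) + chi e"
        using chi_add[of "e * x" e] x e EL by (simp add: L_closed algebra_simps)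
      moreover have "chi (e * x) = t * chi x" "chi (e * (x + 1)) = t' * (chi x + 1)"
        using chi_nz[of x] chi_nz[of "x + 1"] x x0 x1 chi_add[of x 1] chi1
        by (auto simp: t_def t'_def L_closed)
      ultimately show ?thesis by simp
    qed
    then have lin: "(t - t') * chi x = t' - chi e" by (simp add: algebra_simps)
    have "t = t'"
    proof (rule ccontr)
      assume "t \<noteq> t'"
      then have "chi x = (t' - chi e) / (t - t')" using lin by (simp add: field_simps)
      then show False using x tE by (simp add: E_closed)
    qed
    then show ?thesis using lin x chi_nz[of x] x0 by (auto simp: t_def field_simps)
  qed
  \<comment> \<open>If \<open>chi x\<close> lies in \<open>E\<close>, both \<open>z\<close> and \<open>x + z\<close> are generic, and \<open>x\<close> is their difference.\<close>
  have mult: "chi (e * x) = chi e * chi x" if x: "x \<in> L" and e: "e \<in> E" for e x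
  proof (cases "chi x \<in> E")
    case True
    have "chi (x + z) \<notin> E"
    proof
      assume "chi (x + z) \<in> E"
      then have "chi (x + z) - chi x \<in> E" using True by (simp add: E_closed)
      then show False using z x by (simp add: chi_add)
    qed
    moreover have "x + z \<in> L" using x z by (simp add: L_closed)
    ultimately have "chi (e * (x + z)) = chi e * chi (x + z)" using off e by blast
    moreover have "chi (e * z) = chi e * chi z" using off e z by blast
    moreover have "chi (e * (x + z)) = chi (e * x) + chi (e * z)"
      using chi_add[of "e * x" "e * z"] x e z EL by (simp add: L_closed algebra_simps)
    ultimately show ?thesis using x z by (simp add: chi_add algebra_simps)
  qed (use off x e in auto)
  have pow: "chi (beta ^ i) = chi beta ^ i" for i
    by (induction i) (use chi1 mult beta(1) EL in \<open>auto simp: L_closed\<close>)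
  have chi_sum: "chi (\<Sum>i\<in>A. f i) = (\<Sum>i\<in>A. chi (f i))" if "\<And>i. f i \<in> L" for f and A :: "'n set"
  proof -
    have "(\<Sum>i\<in>A. f i) \<in> L \<and> chi (\<Sum>i\<in>A. f i) = (\<Sum>i\<in>A. chi (f i))"
      by (induction A rule: infinite_finite_induct) (use that chi0 in \<open>auto simp: L_closed chi_add\<close>)
    then show ?thesis ..
  qed
  have chi_zeta0: "chi (zeta0 v) = poly (coord_poly v) (chi beta)" for v
    using beta(1) EL unfolding zeta0_def poly_coord_poly
    by (subst chi_sum) (auto simp: L_closed chi_scale pow)
  obtain w where w: "beta ^ N = zeta0 w"
    using L_obtain_coords[of "beta ^ N"] beta(1) EL by (auto simp: L_closed)
  \<comment> \<open>The minimal polynomial of \<^term>\<open>beta\<close> over \<open>F\<close>.\<close>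
  define p where "p = monom 1 N - coord_poly w"
  have "degree p = N"
    using degree_coord_poly[of w] degree_add_eq_left[of "- coord_poly w" "monom 1 N"]
    by (simp add: p_def degree_monom_eq)
  moreover have "poly p (beta ^ (q ^ (k * i))) = 0" for i
  proof -
    have "poly p (beta ^ (q ^ (k * i))) = (beta ^ N) ^ (q ^ (k * i)) - (poly (coord_poly w) beta) ^ (q ^ (k * i))"
      unfolding p_def poly_diff poly_monom poly_coord_poly_conj
      by (simp add: power_commutes power_mult[symmetric] mult.commute[of N])
    then show ?thesis using w by (simp add: zeta0_poly)
  qed
  moreover have "poly p (chi beta) = 0"
    using w chi_zeta0[of w] by (simp add: p_def poly_monom flip: pow)
  ultimately obtain i where i: "i < N" "chi beta = beta ^ (q ^ (k * i))"
    using conjugate_of_beta[of p "chi beta"] N_gt1 by (metis degree_0 less_nat_zero_code le_refl gr_implies_not0)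
  have "psi x = c * x ^ (q ^ (k * i))" if "x \<in> L" for x
  proof -
    obtain v where v: "x = zeta0 v" using L_obtain_coords \<open>x \<in> L\<close> by blast
    have "chi x = x ^ (q ^ (k * i))"
      by (simp add: v chi_zeta0 i poly_coord_poly_conj) (simp add: zeta0_poly)
    then show ?thesis using c by (simp add: chi_def field_simps)
  qed
  then show ?thesis using c i by blast
qed

end

section \<open>Points, matrices and projectivities\<close>

lemma card_fibres:
  assumes "finite S" and "\<And>y. y \<in> S \<Longrightarrow> card {x \<in> S. f x = f y} = c"
  shows "card S = c * card (f ` S)"
proof -
  have "card S = (\<Sum>z\<in>f ` S. card {x \<in> S. f x = z})"
    using sum.group[OF assms(1) finite_imageI[OF assms(1)], of f f "\<lambda>_. 1::nat"] by simp
  also have "\<dots> = (\<Sum>z\<in>f ` S. c)" by (rule sum.cong) (use assms in auto)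
  finally show ?thesis by simp
qed

lemma span_eq_iff:
  fixes x y :: "'a::field ^ 'n"
  assumes "x \<noteq> 0" "y \<noteq> 0"
  shows "vec.span {x} = vec.span {y} \<longleftrightarrow> (\<exists>a. a \<noteq> 0 \<and> y = a *s x)"
proof
  assume "vec.span {x} = vec.span {y}"
  then have "y \<in> vec.span {x}" using vec.span_base[of y "{y}"] by simp
  then obtain a where "y = a *s x" by (auto simp: vec.span_singleton)
  then show "\<exists>a. a \<noteq> 0 \<and> y = a *s x" using assms by (intro exI[of _ a]) auto
next
  assume "\<exists>a. a \<noteq> 0 \<and> y = a *s x"
  then obtain a where a: "a \<noteq> 0" "y = a *s x" by blast
  then have x: "x = inverse a *s y" by (simp add: vector_smult_assoc)
  have "x \<in> vec.span {y}" by (subst x) (rule vec.span_scale, rule vec.span_base, simp)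
  moreover have "y \<in> vec.span {x}" unfolding a(2) by (rule vec.span_scale, rule vec.span_base, simp)
  ultimately show "vec.span {x} = vec.span {y}"
    by (intro subset_antisym vec.span_minimal vec.subspace_span) simp_all
qed

lemma pg_points_eq: "(pg_points :: ('a::field ^ 'n) set set) = {vec.span {x} | x. x \<noteq> 0}"
proof (intro equalityI subsetI)
  fix U :: "('a ^ 'n) set" assume "U \<in> pg_points"
  then have U: "vec.subspace U" "vec.dim U = 1" by (auto simp: pg_points_def)
  obtain B where B: "B \<subseteq> U" "vec.independent B" "U \<subseteq> vec.span B" "card B = vec.dim U"
    using vec.basis_exists by blast
  then obtain x where x: "B = {x}" using U by (metis card_1_singletonE)
  then have "x \<noteq> 0" using B(2) vec.dependent_zero by auto
  moreover have "U = vec.span {x}" using B x U by (metis subset_antisym vec.span_minimal)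
  ultimately show "U \<in> {vec.span {x} | x. x \<noteq> 0}" by blast
qed (auto simp: pg_points_def)

lemma matrix_image_span:
  "(\<lambda>x. (A :: 'a::field ^ 'n ^ 'n) *v x) ` vec.span {x} = vec.span {A *v x}"
  using vec.linear_span_image[OF matrix_vector_mul_linear_gen, of A "{x}"] by simp

lemma invertible_injective:
  fixes A :: "'a::field ^ 'n ^ 'n"
  assumes "invertible A"
  shows "A *v x = A *v y \<longleftrightarrow> x = y"
  using assms by (metis inj_eq invertible_left_inverse matrix_left_invertible_injective)

lemma injective_linear_matrix:
  fixes T :: "'a::field ^ 'n \<Rightarrow> 'a ^ 'n"
  assumes "\<And>x y. T (x + y) = T x + T y" "\<And>a x. T (a *s x) = a *s T x" "inj T"
  shows "\<exists>A. invertible A \<and> (\<forall>x. A *v x = T x)"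
proof -
  have lin: "Vector_Spaces.linear (*s) (*s) T"
    by (simp add: Vector_Spaces.linear_iff assms vec.vector_space_axioms)
  then have "matrix T *v x = T x" for x by (rule matrix_works)
  moreover then have "inj ((*v) (matrix T))" using assms(3) by (simp add: inj_def)
  then have "invertible (matrix T)"
    by (simp add: invertible_left_inverse matrix_left_invertible_injective)
  ultimately show ?thesis by blast
qed

lemma funpow_projectivity:
  fixes A :: "'a::field ^ 'n ^ 'n"
  assumes \<rho>: "\<And>U. U \<in> pg_points \<Longrightarrow> \<rho> U = (\<lambda>x. A *v x) ` U" and A: "invertible A" and x: "x \<noteq> 0"
  shows "(\<rho> ^^ i) (vec.span {x}) = vec.span {((*v) A ^^ i) x}" and "((*v) A ^^ i) x \<noteq> 0"
proof -
  have "(\<rho> ^^ i) (vec.span {x}) = vec.span {((*v) A ^^ i) x} \<and> ((*v) A ^^ i) x \<noteq> 0"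
  proof (induction i)
    case (Suc i)
    then have "vec.span {((*v) A ^^ i) x} \<in> pg_points" by (auto simp: pg_points_eq)
    then show ?case using Suc invertible_injective[OF A, of _ 0] by (simp add: \<rho> matrix_image_span)
  qed (simp add: x)
  then show "(\<rho> ^^ i) (vec.span {x}) = vec.span {((*v) A ^^ i) x}" and "((*v) A ^^ i) x \<noteq> 0" by blast+
qed

section \<open>The partition belonging to an identification of V with L\<close>

context singer_tower
begin

text \<open>
  These identifications of \<open>V\<close> with \<open>L\<close> replace the Singer subgroups of the projective
  group: an identification \<open>\<zeta>\<close> turns \<open>V\<close> into a one-dimensional space over \<open>L\<close>, and the associated
  partition consists of the orbits of the multiplicative group of \<open>E\<close> on the points.
\<close>

definition Iso :: "('a ^ 'n \<Rightarrow> 'a alg_closure) set" where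
  "Iso = {\<zeta>. (\<forall>x y. \<zeta> (x + y) = \<zeta> x + \<zeta> y) \<and> (\<forall>a x. \<zeta> (a *s x) = to_ac a * \<zeta> x) \<and> bij_betw \<zeta> UNIV L}"

definition block :: "('a ^ 'n \<Rightarrow> 'a alg_closure) \<Rightarrow> 'a ^ 'n \<Rightarrow> ('a ^ 'n) set set" where
  "block \<zeta> x = {vec.span {y} | y. y \<noteq> 0 \<and> \<zeta> y / \<zeta> x \<in> G}"

definition block_partition :: "('a ^ 'n \<Rightarrow> 'a alg_closure) \<Rightarrow> ('a ^ 'n) set set set" where
  "block_partition \<zeta> = block \<zeta> ` {x. x \<noteq> 0}"

definition subgeom :: "('a ^ 'n \<Rightarrow> 'a alg_closure) \<Rightarrow> ('a ^ 'n) set set" where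
  "subgeom \<zeta> = {vec.span {y} | y. y \<noteq> 0 \<and> \<zeta> y \<in> E}"

lemma IsoD:
  assumes "\<zeta> \<in> Iso"
  shows "\<zeta> (x + y) = \<zeta> x + \<zeta> y" "\<zeta> (a *s x) = to_ac a * \<zeta> x" "\<zeta> x \<in> L"
    "\<zeta> x = \<zeta> y \<longleftrightarrow> x = y" "\<zeta> x = 0 \<longleftrightarrow> x = 0" "\<zeta> 0 = 0"
    "u \<in> L \<Longrightarrow> \<exists>x. \<zeta> x = u"
proof -
  have bij: "bij_betw \<zeta> UNIV L" using assms by (simp add: Iso_def)
  show "\<zeta> (x + y) = \<zeta> x + \<zeta> y" using assms by (simp add: Iso_def)
  show scale: "\<zeta> (a *s x) = to_ac a * \<zeta> x" for a x using assms by (simp add: Iso_def)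
  show "\<zeta> x \<in> L" using bij_betwE[OF bij] by blast
  show "\<exists>x. \<zeta> x = u" if "u \<in> L"
    using that unfolding bij_betw_imp_surj_on[OF bij, symmetric] by auto
  show inj: "\<zeta> x = \<zeta> y \<longleftrightarrow> x = y" for x y
    using bij_betw_imp_inj_on[OF bij] by (simp add: inj_eq)
  show zero: "\<zeta> 0 = 0" using scale[of 0 0] by simp
  show "\<zeta> x = 0 \<longleftrightarrow> x = 0" using inj[of x 0] by (simp add: zero)
qed

lemma zeta0_Iso: "zeta0 \<in> Iso"
  using bij_zeta0 by (simp add: Iso_def zeta0_add zeta0_scale)

lemma Iso_comp_matrix:
  assumes "\<zeta> \<in> Iso" "invertible A"
  shows "(\<lambda>x. \<zeta> (A *v x)) \<in> Iso"
proof -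
  have inj: "inj ((*v) A)" using invertible_injective[OF assms(2)] by (simp add: inj_def)
  then have "bij ((*v) A)" using finite_UNIV_inj_surj[of "(*v) A"] by (simp add: bij_def)
  moreover have "bij_betw \<zeta> UNIV L" using assms by (simp add: Iso_def)
  ultimately have "bij_betw (\<zeta> \<circ> (*v) A) UNIV L" by (rule bij_betw_trans)
  then show ?thesis using IsoD(1,2)[OF assms(1)]
    by (simp add: Iso_def o_def vec.add vec.scale)
qed

lemma Iso_matrix:
  fixes \<eta> :: "'a ^ 'n \<Rightarrow> 'a alg_closure"
  assumes "\<zeta> \<in> Iso" and add: "\<And>x y. \<eta> (x + y) = \<eta> x + \<eta> y"
    and scale: "\<And>a x. \<eta> (a *s x) = to_ac a * \<eta> x" and ran: "\<And>x. \<eta> x \<in> L" and "inj \<eta>"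
  shows "\<exists>A. invertible A \<and> (\<forall>x. \<zeta> (A *v x) = \<eta> x)"
proof -
  define T where "T x = (SOME y. \<zeta> y = \<eta> x)" for x
  have T: "\<zeta> (T x) = \<eta> x" for x
    unfolding T_def by (rule someI_ex) (use IsoD(7)[OF assms(1)] ran in blast)
  have "\<exists>A. invertible A \<and> (\<forall>x. A *v x = T x)"
  proof (rule injective_linear_matrix)
    show "T (x + y) = T x + T y" for x y
      by (subst IsoD(4)[OF assms(1), symmetric]) (simp add: T IsoD(1)[OF assms(1)] add)
    show "T (a *s x) = a *s T x" for a x
      by (subst IsoD(4)[OF assms(1), symmetric]) (simp add: T IsoD(2)[OF assms(1)] scale)
    show "inj T" using assms(5) by (metis T injD injI)
  qed
  then show ?thesis using T by auto
qed

lemma Iso_eq_matrix: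
  assumes "\<zeta> \<in> Iso" "\<xi> \<in> Iso"
  shows "\<exists>A. invertible A \<and> (\<forall>x. \<zeta> (A *v x) = \<xi> x)"
  by (rule Iso_matrix[OF assms(1)]) (use IsoD[OF assms(2)] in \<open>auto simp: inj_def\<close>)

lemma Iso_mult_matrix:
  assumes "\<zeta> \<in> Iso" "\<alpha> \<in> L" "\<alpha> \<noteq> 0"
  shows "\<exists>A. invertible A \<and> (\<forall>x. \<zeta> (A *v x) = \<alpha> * \<zeta> x)"
  by (rule Iso_matrix[OF assms(1)])
     (use IsoD[OF assms(1)] assms(2,3) in \<open>auto simp: inj_def algebra_simps L_closed\<close>)

lemma mem_block:
  assumes "\<zeta> \<in> Iso" "x \<noteq> 0" "y \<noteq> 0"
  shows "vec.span {y} \<in> block \<zeta> x \<longleftrightarrow> \<zeta> y / \<zeta> x \<in> G"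
proof
  assume "vec.span {y} \<in> block \<zeta> x"
  then obtain y' where y': "vec.span {y} = vec.span {y'}" "y' \<noteq> 0" "\<zeta> y' / \<zeta> x \<in> G"
    by (auto simp: block_def)
  then obtain a where a: "a \<noteq> 0" "y = a *s y'" using span_eq_iff[of y' y] assms by auto
  have "\<zeta> y / \<zeta> x = to_ac a * (\<zeta> y' / \<zeta> x)" by (simp add: a IsoD(2)[OF assms(1)])
  then show "\<zeta> y / \<zeta> x \<in> G" using G_mult[OF to_ac_G[OF a(1)] y'(3)] by (simp only:)
qed (use assms in \<open>auto simp: block_def\<close>)

text \<open>
  In the coordinate \<open>\<zeta>\<close> the projectivity is multiplication by \<open>\<alpha>\<close>, so the orbit of a point consists of
  its multiples by powers of \<open>\<alpha>\<close>; up to scalars these are the multiples by elements of \<open>G\<close>. The exponent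
  has to be positive because an orbit is formed with at least one application of the map.
\<close>

lemma orbit_eq_block:
  assumes \<zeta>: "\<zeta> \<in> Iso" and \<rho>: "\<And>U. U \<in> pg_points \<Longrightarrow> \<rho> U = (\<lambda>x. A *v x) ` U"
    and inv: "invertible A" and A: "\<And>x. \<zeta> (A *v x) = \<alpha> * \<zeta> x" and \<alpha>: "\<alpha> \<in> G"
    and gen: "\<And>g. g \<in> G \<Longrightarrow> \<exists>s i. s \<noteq> 0 \<and> i > 0 \<and> g = to_ac s * \<alpha> ^ i" and x: "x \<noteq> 0"
  shows "orbit \<rho> (vec.span {x}) = block \<zeta> x"
proof -
  define T where "T i = ((*v) A ^^ i) x" for i
  have \<zeta>T: "\<zeta> (T i) = \<alpha> ^ i * \<zeta> x" for i
    by (induction i) (auto simp: T_def A)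
  have pow: "(\<rho> ^^ i) (vec.span {x}) = vec.span {T i}" and T0: "T i \<noteq> 0" for i
    using funpow_projectivity[OF \<rho> inv x] by (simp_all add: T_def)
  have \<zeta>x: "\<zeta> x \<noteq> 0" using x IsoD(5)[OF \<zeta>] by simp
  show ?thesis
  proof (intro equalityI subsetI)
    fix U assume "U \<in> orbit \<rho> (vec.span {x})"
    then obtain i where i: "U = vec.span {T i}" "i > 0" by (auto simp: orbit_altdef pow)
    have "\<alpha> ^ i \<in> G" using i(2)
      by (induction i rule: nat_induct_non_zero) (auto intro: G_mult \<alpha>)
    then show "U \<in> block \<zeta> x" unfolding i by (simp add: mem_block[OF \<zeta> x T0] \<zeta>T \<zeta>x)
  next
    fix U assume "U \<in> block \<zeta> x"
    then obtain y where y: "U = vec.span {y}" "y \<noteq> 0" "\<zeta> y / \<zeta> x \<in> G" by (auto simp: block_def)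
    then obtain s i where si: "s \<noteq> 0" "i > 0" "\<zeta> y / \<zeta> x = to_ac s * \<alpha> ^ i" using gen by blast
    then have "\<zeta> y = \<zeta> (s *s T i)" using \<zeta>x by (simp add: IsoD(2)[OF \<zeta>] \<zeta>T field_simps)
    then have "y = s *s T i" using IsoD(4)[OF \<zeta>] by blast
    then have "U = vec.span {T i}" using span_eq_iff[OF T0 y(2)] si y by metis
    then show "U \<in> orbit \<rho> (vec.span {x})" using si(2) pow by (auto simp: orbit_altdef intro!: exI[of _ i])
  qed
qed

lemma determined_partition_eq_part:
  assumes \<zeta>: "\<zeta> \<in> Iso" and \<rho>: "\<And>U. U \<in> pg_points \<Longrightarrow> \<rho> U = (\<lambda>x. A *v x) ` U"
    and inv: "invertible A" and A: "\<And>x. \<zeta> (A *v x) = \<alpha> * \<zeta> x" and \<alpha>: "\<alpha> \<in> G"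
    and gen: "\<And>g. g \<in> G \<Longrightarrow> \<exists>s i. s \<noteq> 0 \<and> i > 0 \<and> g = to_ac s * \<alpha> ^ i"
  shows "determined_partition \<rho> = block_partition \<zeta>"
proof -
  have "orbit \<rho> ` pg_points = (\<lambda>x. orbit \<rho> (vec.span {x})) ` {x. x \<noteq> 0}"
    by (auto simp: pg_points_eq)
  also have "\<dots> = block \<zeta> ` {x. x \<noteq> 0}"
    by (rule image_cong[OF refl]) (use orbit_eq_block[OF assms] in auto)
  finally show ?thesis by (simp add: determined_partition_def block_partition_def)
qed

lemma beta_gen:
  assumes "g \<in> G"
  shows "\<exists>s i. s \<noteq> 0 \<and> i > 0 \<and> g = to_ac s * beta ^ i"
proof -
  obtain a e where g: "g = to_ac a * e" "a \<noteq> 0" "e \<in> E" "e \<noteq> 0" using assms by (auto simp: G_def)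
  obtain i where "e = beta ^ i" using beta(3)[OF g(3,4)] by blast
  moreover have "beta ^ (q ^ N - 1) = 1"
    using gf_unit_power[of beta "q ^ N"] beta(1,2) by (simp add: E_def)
  ultimately have "e = beta ^ (i + (q ^ N - 1))" by (simp add: power_add)
  moreover have "q ^ N > 1" using one_less_power[OF q_gt1] N_gt1 by simp
  ultimately show ?thesis using g by (intro exI[of _ a] exI[of _ "i + (q ^ N - 1)"]) auto
qed

lemma subfield_eq_Fq:
  assumes "is_subfield (F :: 'a set)" "card F = q"
  shows "F = Fq"
proof (rule card_subset_eq)
  show "F \<subseteq> Fq" using subfield_eq_gf[OF assms(1)] assms(2) by (auto simp: gf_def Fq_def)
qed (simp_all add: card_Fq assms)

lemma is_subfield_Fq: "is_subfield Fq"
  using gf_subfield[of 1] by (auto simp: is_subfield_def Fq_iff)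

lemma zeta0_in_E: "zeta0 v \<in> E \<longleftrightarrow> (\<forall>i. v $ i \<in> Fq)"
proof
  assume "zeta0 v \<in> E"
  then obtain w :: "'a ^ 'n" where "\<forall>i. w $ i \<in> Fq" "zeta0 v = zeta0 w" unfolding zeta0_lattice[symmetric] by auto
  then show "\<forall>i. v $ i \<in> Fq" by (simp add: inj_eq[OF inj_zeta0])
qed (auto simp flip: zeta0_lattice)

lemma points_over_Fq: "points_over Fq = subgeom zeta0"
  by (simp add: points_over_def subgeom_def zeta0_in_E)

lemma matrix_image_subgeom:
  assumes A: "\<And>x. \<xi> (A *v x) = \<zeta> x" and inv: "invertible A"
  shows "(\<lambda>U. (\<lambda>x. A *v x) ` U) ` subgeom \<zeta> = subgeom \<xi>"
proof -
  have surj: "\<exists>x. y = A *v x" for y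
    using inv by (metis invertible_right_inverse matrix_right_invertible_surjective surjD)
  have A0: "A *v x = 0 \<longleftrightarrow> x = 0" for x
    using invertible_injective[OF inv, of x 0] by simp
  show ?thesis
  proof (intro equalityI subsetI)
    fix U assume "U \<in> (\<lambda>U. (\<lambda>x. A *v x) ` U) ` subgeom \<zeta>"
    then obtain x where x: "x \<noteq> 0" "\<zeta> x \<in> E" "U = (\<lambda>x. A *v x) ` vec.span {x}" by (auto simp: subgeom_def)
    then have "U = vec.span {A *v x}" "A *v x \<noteq> 0" "\<xi> (A *v x) \<in> E"
      by (simp_all add: matrix_image_span A A0)
    then show "U \<in> subgeom \<xi>" unfolding subgeom_def by blast
  next
    fix U assume "U \<in> subgeom \<xi>"
    then obtain y where y: "y \<noteq> 0" "\<xi> y \<in> E" "U = vec.span {y}" by (auto simp: subgeom_def)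
    obtain x where x: "y = A *v x" using surj by blast
    then have "vec.span {x} \<in> subgeom \<zeta>" using y A A0 by (auto simp: subgeom_def)
    then show "U \<in> (\<lambda>U. (\<lambda>x. A *v x) ` U) ` subgeom \<zeta>"
      using y(3) x matrix_image_span[of A x] by (intro image_eqI[of _ _ "vec.span {x}"]) simp_all
  qed
qed

lemma subgeom_points: "subgeom \<zeta> \<subseteq> pg_points"
  by (auto simp: subgeom_def pg_points_eq)

text \<open>
  The canonical subgeometry corresponds to \<open>E\<close> under \<^term>\<open>zeta0\<close>, and composing \<^term>\<open>zeta0\<close> with
  invertible matrices gives all identifications.
\<close>

lemma subgeometry_iff: "subgeometry q B \<longleftrightarrow> (\<exists>\<xi>\<in>Iso. B = subgeom \<xi>)"
proof
  assume "subgeometry q B"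
  then obtain F \<tau> where F: "is_subfield F" "card F = q" "projectivity \<tau>" "B = \<tau> ` points_over F"
    by (auto simp: subgeometry_def)
  then have B: "B = \<tau> ` subgeom zeta0" using subfield_eq_Fq points_over_Fq by metis
  obtain A where A: "invertible A" "\<And>U. U \<in> pg_points \<Longrightarrow> \<tau> U = (\<lambda>x. A *v x) ` U"
    using F(3) by (auto simp: projectivity_def)
  obtain A' where A': "A ** A' = mat 1" "A' ** A = mat 1" using A(1) by (auto simp: invertible_def)
  then have "invertible A'" by (auto simp: invertible_def)
  then have "(\<lambda>x. zeta0 (A' *v x)) \<in> Iso" by (rule Iso_comp_matrix[OF zeta0_Iso])
  moreover have "B = (\<lambda>U. (\<lambda>x. A *v x) ` U) ` subgeom zeta0"
    unfolding B by (rule image_cong[OF refl]) (use A(2) subgeom_points in blast)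
  moreover have "\<dots> = subgeom (\<lambda>x. zeta0 (A' *v x))"
    by (rule matrix_image_subgeom) (simp_all add: A A' matrix_vector_mul_assoc)
  ultimately show "\<exists>\<xi>\<in>Iso. B = subgeom \<xi>" by metis
next
  assume "\<exists>\<xi>\<in>Iso. B = subgeom \<xi>"
  then obtain \<xi> where \<xi>: "\<xi> \<in> Iso" "B = subgeom \<xi>" by blast
  obtain A where A: "invertible A" "\<And>x. \<xi> (A *v x) = zeta0 x" using Iso_eq_matrix[OF \<xi>(1) zeta0_Iso] by blast
  show "subgeometry q B" unfolding subgeometry_def
  proof (intro exI conjI)
    show "is_subfield Fq" "card Fq = q" by (rule is_subfield_Fq card_Fq)+
    show "projectivity (\<lambda>U. (\<lambda>x. A *v x) ` U)" using A(1) by (auto simp: projectivity_def)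
    show "B = (\<lambda>U. (\<lambda>x. A *v x) ` U) ` points_over Fq"
      using matrix_image_subgeom[of \<xi> A zeta0, OF A(2,1)] by (simp add: \<xi> points_over_Fq)
  qed
qed

lemma subgeom_eq_block:
  assumes "\<zeta> \<in> Iso" "\<zeta> x = 1"
  shows "subgeom \<zeta> = block \<zeta> x"
proof (intro equalityI subsetI)
  fix U assume "U \<in> subgeom \<zeta>"
  then show "U \<in> block \<zeta> x" using assms IsoD(5)[OF assms(1)] E_sub_G by (auto simp: subgeom_def block_def)
next
  fix U assume "U \<in> block \<zeta> x"
  then obtain y where y: "U = vec.span {y}" "y \<noteq> 0" "\<zeta> y \<in> G" using assms by (auto simp: block_def)
  then obtain a e where ae: "\<zeta> y = to_ac a * e" "a \<noteq> 0" "e \<in> E" by (auto simp: G_def)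
  have "\<zeta> (inverse a *s y) = e" using ae by (simp add: IsoD(2)[OF assms(1)])
  moreover have "vec.span {y} = vec.span {inverse a *s y}"
    using ae y by (subst span_eq_iff) auto
  moreover have "inverse a *s y \<noteq> 0" using ae y by simp
  ultimately show "U \<in> subgeom \<zeta>" using y ae(3) unfolding subgeom_def by blast
qed

text \<open>
  Multiplication by \<^term>\<open>beta\<close>, transported to \<open>V\<close>, is a projectivity with these orbits, and it acts
  cyclically on the orbit of the point that corresponds to \<open>1\<close>, which is a subgeometry.
\<close>

lemma part_in_cyclic_partitions:
  assumes \<zeta>: "\<zeta> \<in> Iso"
  shows "block_partition \<zeta> \<in> cyclic_partitions q"
proof -
  have \<beta>: "beta \<in> L" "beta \<noteq> 0" "beta \<in> G" using beta E_sub_L E_sub_G by auto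
  obtain A where A: "invertible A" "\<And>x. \<zeta> (A *v x) = beta * \<zeta> x"
    using Iso_mult_matrix[OF \<zeta> \<beta>(1,2)] by blast
  define \<rho> where "\<rho> U = (\<lambda>x. A *v x) ` U" for U
  have \<rho>: "projectivity \<rho>" using A(1) by (auto simp: projectivity_def \<rho>_def)
  have dp: "determined_partition \<rho> = block_partition \<zeta>"
    by (rule determined_partition_eq_part[OF \<zeta> \<rho>_def A(1,2) \<beta>(3) beta_gen])
  obtain x where x: "\<zeta> x = 1" using IsoD(7)[OF \<zeta> L_closed(7)] by blast
  then have x0: "x \<noteq> 0" using IsoD(6)[OF \<zeta>] by auto
  have orb: "orbit \<rho> (vec.span {x}) = subgeom \<zeta>"
    using orbit_eq_block[OF \<zeta> \<rho>_def A(1,2) \<beta>(3) beta_gen x0] subgeom_eq_block[OF \<zeta> x] by simp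
  have mem: "vec.span {x} \<in> subgeom \<zeta>" using x x0 by (auto simp: subgeom_def E_closed)
  then have cyc: "cyclic_on \<rho> (subgeom \<zeta>)" using orb unfolding cyclic_on_def by blast
  have "\<rho> ` subgeom \<zeta> = subgeom \<zeta>"
  proof (intro equalityI subsetI)
    fix U assume "U \<in> subgeom \<zeta>"
    then have "U \<in> orbit \<rho> (vec.span {x})" by (simp add: orb)
    then show "U \<in> \<rho> ` subgeom \<zeta>" using mem by cases (auto simp: orb)
  qed (use cyclic_on_inI[OF cyc] in auto)
  then have "acts_cyclically \<rho> (subgeom \<zeta>)" using cyc by (simp add: acts_cyclically_def)
  moreover have "subgeometry q (subgeom \<zeta>)" using subgeometry_iff \<zeta> by blast
  ultimately show ?thesis using \<rho> dp unfolding cyclic_partitions_def by blast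
qed

end

section \<open>Every cyclic projectivity comes from such an identification\<close>

text \<open>
  Composition with a map \<open>T\<close> of finite order has an eigenfunction in the span of the translates
  \<open>\<zeta> \<circ> T\<^sup>i\<close> of any nonzero function \<open>\<zeta>\<close> with values in an algebraically closed field. Polynomials act on functions through
  \<open>T\<close>, and \<open>X\<^sup>r - 1\<close> annihilates \<open>\<zeta>\<close>. Take an annihilating polynomial \<open>p\<close> of least degree and split off a
  linear factor \<open>X - \<alpha>\<close>; the cofactor \<open>h\<close> does not annihilate \<open>\<zeta>\<close>, and its action on \<open>\<zeta>\<close> is the
  eigenfunction.
\<close>

lemma exists_eigenfunctional:
  fixes T :: "'v \<Rightarrow> 'v" and \<zeta> :: "'v \<Rightarrow> 'c::alg_closed_field"
  assumes r: "r > 0" and T: "\<And>y. (T ^^ r) y = y" and nz: "\<zeta> y0 \<noteq> 0"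
  obtains \<alpha> c and M :: nat and y1 where "(\<Sum>i\<le>M. c i * \<zeta> ((T ^^ i) y1)) \<noteq> 0"
    and "\<And>y. (\<Sum>i\<le>M. c i * \<zeta> ((T ^^ i) (T y))) = \<alpha> * (\<Sum>i\<le>M. c i * \<zeta> ((T ^^ i) y))"
proof -
  define act where "act p y = (\<Sum>i\<le>degree p. coeff p i * \<zeta> ((T ^^ i) y))" for p y
  have act_bound: "act p y = (\<Sum>i\<le>m. coeff p i * \<zeta> ((T ^^ i) y))" if "degree p \<le> m" for p m y
    unfolding act_def using that
    by (intro sum.mono_neutral_left) (auto simp: coeff_eq_0)
  have act_add: "act (p + h) y = act p y + act h y" for p h y
    using act_bound[OF degree_add_le_max, of p h y]
      act_bound[of p "max (degree p) (degree h)" y] act_bound[of h "max (degree p) (degree h)" y]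
    by (simp add: sum.distrib algebra_simps)
  have act_smult: "act (smult b p) y = b * act p y" for b p y
    using act_bound[OF degree_smult_le, of b p y] by (simp add: act_def sum_distrib_left mult_ac)
  have act_pCons: "act (pCons b p) y = b * \<zeta> y + act p (T y)" for b p y
  proof -
    have "act (pCons b p) y = (\<Sum>i\<le>Suc (degree p). coeff (pCons b p) i * \<zeta> ((T ^^ i) y))"
      by (rule act_bound) (rule degree_pCons_le)
    also have "\<dots> = b * \<zeta> y + act p (T y)"
      unfolding act_def sum.atMost_Suc_shift by (simp add: funpow_swap1)
    finally show ?thesis .
  qed
  define ann where "ann p \<longleftrightarrow> p \<noteq> 0 \<and> (\<forall>y. act p y = 0)" for p
  have "ann (monom 1 r + [:-1:])"
  proof -
    have "act (monom 1 r) y = \<zeta> y" for y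
    proof -
      have "act (monom 1 r) y = (\<Sum>i\<le>r. if i = r then \<zeta> ((T ^^ r) y) else 0)"
        unfolding act_def by (rule sum.cong) (auto simp: degree_monom_eq)
      then show ?thesis by (simp add: T)
    qed
    moreover have "act [:-1:] y = - \<zeta> y" for y by (simp add: act_def)
    moreover have "coeff (monom 1 r + [:-1:]) r = (1::'c)"
      using r by (simp add: coeff_pCons split: nat.splits)
    ultimately show ?thesis unfolding ann_def act_add by (metis add.right_inverse coeff_0 zero_neq_one)
  qed
  then obtain p where p: "ann p" and min: "\<And>h. ann h \<Longrightarrow> degree p \<le> degree h"
    using ex_has_least_nat[of ann _ degree] by blast
  have "degree p > 0"
  proof (rule ccontr)
    assume "\<not> degree p > 0"
    then obtain b where "p = [:b:]" by (metis degree_eq_zeroE gr0I)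
    then show False using p nz by (auto simp: ann_def act_def)
  qed
  then obtain \<alpha> where "poly p \<alpha> = 0" using alg_closed_imp_poly_has_root by blast
  then obtain h where h: "p = [:-\<alpha>, 1:] * h" by (auto simp: poly_eq_0_iff_dvd)
  then have h0: "h \<noteq> 0" using p by (auto simp: ann_def)
  have "degree p = Suc (degree h)" unfolding h using h0 by (subst degree_mult_eq) auto
  then have "\<not> ann h" using min[of h] by auto
  then obtain y1 where y1: "act h y1 \<noteq> 0" using h0 by (auto simp: ann_def)
  have "act h (T y) = \<alpha> * act h y" for y
  proof -
    have "p = pCons 0 h + smult (- \<alpha>) h" by (simp add: h)
    then have "act p y = act h (T y) - \<alpha> * act h y" by (simp only: act_add act_pCons act_smult) simp
    then show ?thesis using p by (simp add: ann_def)
  qed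
  then show ?thesis using that[of "coeff h" y1 "degree h" \<alpha>] y1 by (simp add: act_def)
qed

lemma injective_funpow_period:
  fixes T :: "'v::finite \<Rightarrow> 'v"
  assumes "inj T"
  obtains r where "r > 0" "\<And>y. (T ^^ r) y = y"
proof -
  have "\<not> inj (\<lambda>i::nat. T ^^ i)"
    using finite_imageD[of "\<lambda>i::nat. T ^^ i" UNIV] by auto
  then obtain i l where "i < l" "T ^^ i = T ^^ l"
    unfolding inj_def by (metis linorder_neqE_nat)
  then have "(T ^^ i) ((T ^^ (l - i)) y) = (T ^^ i) y" for y
    by (metis add_diff_inverse_nat comp_apply funpow_add nat_less_le not_le)
  moreover have "inj (T ^^ i)" using assms by (rule inj_fn)
  ultimately have "(T ^^ (l - i)) y = y" for y by (auto dest: injD)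
  then show ?thesis using that[of "l - i"] \<open>i < l\<close> by simp
qed

context singer_tower
begin

lemma mem_subgeom:
  assumes "\<xi> \<in> Iso" "y \<noteq> 0"
  shows "vec.span {y} \<in> subgeom \<xi> \<longleftrightarrow> \<xi> y \<in> G"
proof -
  obtain x where x: "\<xi> x = 1" using IsoD(7)[OF assms(1) L_closed(7)] by blast
  then have "x \<noteq> 0" using IsoD(6)[OF assms(1)] by auto
  then show ?thesis using subgeom_eq_block[OF assms(1) x] mem_block[OF assms(1) _ assms(2)] x by simp
qed

lemma lattice_spans:
  assumes "\<xi> \<in> Iso"
  obtains b :: "'n \<Rightarrow> 'a ^ 'n" where "\<And>i. \<xi> (b i) = beta ^ idx i"
    and "\<And>y. \<exists>v. y = (\<Sum>i\<in>UNIV. v i *s b i)"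
proof -
  have "\<exists>x. \<xi> x = beta ^ idx i" for i
    using IsoD(7)[OF assms, of "beta ^ idx i"] beta(1) E_sub_L by (meson E_closed(5) subsetD)
  then obtain b where b: "\<And>i. \<xi> (b i) = beta ^ idx i" by metis
  have "\<exists>v. y = (\<Sum>i\<in>UNIV. v i *s b i)" for y
  proof -
    obtain v where v: "\<xi> y = zeta0 v" using L_obtain_coords IsoD(3)[OF assms] by blast
    have "\<xi> (\<Sum>i\<in>A. (v $ i) *s b i) = (\<Sum>i\<in>A. to_ac (v $ i) * beta ^ idx i)" for A
      by (induction A rule: infinite_finite_induct) (simp_all add: IsoD(1,2,6)[OF assms] b)
    then have "\<xi> (\<Sum>i\<in>UNIV. (v $ i) *s b i) = \<xi> y" by (simp add: v zeta0_def)
    then have "(\<Sum>i\<in>UNIV. (v $ i) *s b i) = y" using IsoD(4)[OF assms] by blast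
    then show ?thesis by (intro exI[of _ "\<lambda>i. v $ i"]) simp
  qed
  then show ?thesis using that b by blast
qed

text \<open>
  Here \<open>T\<close> acts on the lattice of those \<open>y\<close> with \<open>\<xi> y\<close> in \<open>E\<close>, and it is transitive on the points of
  the subgeometry. An eigenfunctional \<open>\<eta>\<close> with \<open>\<eta> x0 = 1\<close> therefore maps the set \<open>\<Lambda>\<close> of nonzero
  lattice vectors onto the products of nonzero elements of \<open>GF(q)\<close> with powers of the eigenvalue. This set is closed
  under multiplication and has \<open>q ^ N - 1\<close> elements, so it is the multiplicative group of \<open>E\<close>. As \<open>\<Lambda>\<close>
  spans \<open>V\<close> and \<open>E\<close> spans \<open>L\<close>, the functional identifies \<open>V\<close> with \<open>L\<close>.
\<close>

lemma eigenfunctional_in_Iso: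
  assumes \<xi>: "\<xi> \<in> Iso" and add: "\<And>x y. \<eta> (x + y) = \<eta> x + \<eta> y"
    and scale: "\<And>a x. \<eta> (a *s x) = to_ac a * \<eta> x"
    and eig: "\<And>x. \<eta> (T x) = \<alpha> * \<eta> x" and \<alpha>: "\<alpha> \<noteq> 0"
    and lin: "\<And>a x. T (a *s x) = a *s T x"
    and x0: "\<xi> x0 = 1" "\<eta> x0 = 1"
    and T: "\<And>y. \<xi> y \<in> E \<Longrightarrow> \<xi> (T y) \<in> E"
    and trans: "\<And>y. y \<noteq> 0 \<Longrightarrow> \<xi> y \<in> E \<Longrightarrow> \<exists>s i. s \<noteq> 0 \<and> y = s *s (T ^^ i) x0"
  shows "\<eta> \<in> Iso" "\<alpha> \<in> E" "\<And>e. e \<in> E \<Longrightarrow> e \<noteq> 0 \<Longrightarrow> \<exists>s i. s \<noteq> 0 \<and> e = to_ac s * \<alpha> ^ i"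
proof -
  define \<Lambda> where "\<Lambda> = {y. y \<noteq> 0 \<and> \<xi> y \<in> E}"
  have Ti: "\<xi> ((T ^^ i) x0) \<in> E" for i by (induction i) (simp_all add: x0 T E_closed)
  have \<eta>Ti: "\<eta> ((T ^^ i) x0) = \<alpha> ^ i" for i by (induction i) (simp_all add: x0 eig)
  have \<eta>0: "\<eta> 0 = 0" using scale[of 0 0] by simp
  have Ti0: "(T ^^ i) x0 \<noteq> 0" for i using \<eta>Ti[of i] \<alpha> \<eta>0 by auto
  have form: "\<exists>s i. s \<noteq> 0 \<and> s \<in> Fq \<and> y = s *s (T ^^ i) x0" if y: "y \<in> \<Lambda>" for y
  proof -
    obtain s i where si: "s \<noteq> 0" "y = s *s (T ^^ i) x0" using trans[of y] y by (auto simp: \<Lambda>_def)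
    then have "to_ac s = \<xi> y / \<xi> ((T ^^ i) x0)" using Ti0 by (simp add: IsoD[OF \<xi>])
    then have "to_ac s \<in> E" using y Ti by (simp add: \<Lambda>_def E_closed)
    then have "s \<in> Fq" using E_inter_F[OF _ to_ac_in_gf] by (simp add: Fq_iff)
    then show ?thesis using si by blast
  qed
  have multiples: "s *s (T ^^ i) x0 \<in> \<Lambda>" if "s \<noteq> 0" "s \<in> Fq" for s i
    using that gf_q_sub(1) Ti0 Ti by (auto simp: \<Lambda>_def IsoD[OF \<xi>] Fq_iff intro!: E_closed)
  have \<eta>\<Lambda>: "\<eta> ` \<Lambda> = {to_ac s * \<alpha> ^ i | s i. s \<noteq> 0 \<and> s \<in> Fq}"
  proof (intro equalityI subsetI)
    fix u assume "u \<in> \<eta> ` \<Lambda>"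
    then show "u \<in> {to_ac s * \<alpha> ^ i | s i. s \<noteq> 0 \<and> s \<in> Fq}" using form by (force simp: scale \<eta>Ti)
  next
    fix u assume "u \<in> {to_ac s * \<alpha> ^ i | s i. s \<noteq> 0 \<and> s \<in> Fq}"
    then obtain s i where "u = \<eta> (s *s (T ^^ i) x0)" "s \<noteq> 0" "s \<in> Fq" by (auto simp: scale \<eta>Ti)
    then show "u \<in> \<eta> ` \<Lambda>" using multiples by blast
  qed
  have Fq_mult: "s * t \<in> Fq" if "s \<in> Fq" "t \<in> Fq" for s t
    using that by (simp add: Fq_iff gf_mult)
  have nz: "0 \<notin> \<eta> ` \<Lambda>" using \<alpha> by (auto simp: \<eta>\<Lambda>)
  have closed: "u * w \<in> \<eta> ` \<Lambda>" if uw: "u \<in> \<eta> ` \<Lambda>" "w \<in> \<eta> ` \<Lambda>" for u w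
  proof -
    obtain s i t l where *: "u = to_ac s * \<alpha> ^ i" "w = to_ac t * \<alpha> ^ l" "s \<noteq> 0" "t \<noteq> 0" "s \<in> Fq" "t \<in> Fq"
      using uw unfolding \<eta>\<Lambda> by blast
    have "u * w = to_ac (s * t) * \<alpha> ^ (i + l)" by (simp add: * power_add mult_ac)
    moreover have "s * t \<noteq> 0" "s * t \<in> Fq" using * Fq_mult by auto
    ultimately show ?thesis unfolding \<eta>\<Lambda> by blast
  qed
  have inj\<xi>: "inj_on \<xi> \<Lambda>" using IsoD(4)[OF \<xi>] by (simp add: inj_on_def)
  have "\<xi> ` \<Lambda> = E - {0}"
  proof (intro equalityI subsetI)
    fix u assume "u \<in> E - {0}"
    then obtain y where "\<xi> y = u" using IsoD(7)[OF \<xi>] E_sub_L by blast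
    then show "u \<in> \<xi> ` \<Lambda>" using \<open>u \<in> E - {0}\<close> IsoD(6)[OF \<xi>] by (auto simp: \<Lambda>_def intro!: image_eqI[of _ _ y])
  qed (auto simp: \<Lambda>_def IsoD(5)[OF \<xi>])
  then have card\<Lambda>: "card \<Lambda> = q ^ N - 1"
    using card_image[OF inj\<xi>] card_E by (simp add: E_closed)
  have "inj_on \<eta> \<Lambda>"
  proof (rule inj_onI)
    fix y z assume yz: "y \<in> \<Lambda>" "z \<in> \<Lambda>" "\<eta> y = \<eta> z"
    define w where "w = y + (-1) *s z"
    have "\<eta> w = 0" unfolding w_def add scale using yz by simp
    moreover have "\<xi> w \<in> E"
      unfolding w_def IsoD(1,2)[OF \<xi>] using yz by (auto simp: \<Lambda>_def intro!: E_closed)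
    ultimately have "w = 0" using nz unfolding \<Lambda>_def by force
    then show "y = z" by (simp add: w_def)
  qed
  then have card\<eta>: "card (\<eta> ` \<Lambda>) = q ^ N - 1" using card_image card\<Lambda> by metis
  have in_E: "\<eta> ` \<Lambda> \<subseteq> E - {0}"
  proof
    fix u assume u: "u \<in> \<eta> ` \<Lambda>"
    have "u ^ (q ^ N - 1) = 1"
      using finite_mult_closed_power_card[OF _ nz closed u] card\<eta> by simp
    then have "u ^ Suc (q ^ N - 1) = u" by (simp only: power_Suc mult_1_right)
    moreover have "Suc (q ^ N - 1) = q ^ N" by simp
    ultimately have "u ^ (q ^ N) = u" by (simp only:)
    then have "u \<in> E" by (simp only: E_def gf_def mem_Collect_eq)
    then show "u \<in> E - {0}" using nz u by auto
  qed
  then have img: "\<eta> ` \<Lambda> = E - {0}"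
    using card\<eta> card_E by (intro card_subset_eq) (auto simp: E_closed)
  show "\<exists>s i. s \<noteq> 0 \<and> e = to_ac s * \<alpha> ^ i" if "e \<in> E" "e \<noteq> 0" for e
    using that img unfolding \<eta>\<Lambda> by blast
  have "1 \<in> Fq" by (simp add: Fq_def)
  then have "\<alpha> \<in> \<eta> ` \<Lambda>" unfolding \<eta>\<Lambda> by (auto intro!: exI[of _ 1] exI[of _ "1::nat"])
  then show "\<alpha> \<in> E" using in_E by blast
  have \<eta>E: "\<eta> y \<in> E" if "\<xi> y \<in> E" for y
    using that in_E \<eta>0 E_closed(6) unfolding \<Lambda>_def by (cases "y = 0") auto
  have \<eta>sum: "\<eta> (\<Sum>i\<in>A. v i *s b i) = (\<Sum>i\<in>A. to_ac (v i) * \<eta> (b i))" for v and b :: "'n \<Rightarrow> _" and A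
    by (induction A rule: infinite_finite_induct) (simp_all add: add scale \<eta>0)
  have "range \<eta> = L"
  proof (intro equalityI subsetI)
    fix u assume "u \<in> range \<eta>"
    then obtain y where y: "u = \<eta> y" by blast
    obtain b where b: "\<And>i. \<xi> (b i) = beta ^ idx i" "\<And>y. \<exists>v. y = (\<Sum>i\<in>UNIV. v i *s b i)"
      using lattice_spans[OF \<xi>] by blast
    have bL: "\<eta> (b i) \<in> L" for i using \<eta>E[of "b i"] b(1) beta(1) E_sub_L by (auto simp: E_closed)
    obtain v where v: "y = (\<Sum>i\<in>UNIV. v i *s b i)" using b(2) by blast
    have "to_ac (v i) * \<eta> (b i) \<in> L" for i using to_ac_L bL by (rule L_closed(2))
    then show "u \<in> L" unfolding y v \<eta>sum unfolding L_def by (rule gf_sum)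
  next
    fix u assume "u \<in> L"
    then obtain v where v: "u = zeta0 v" using L_obtain_coords by blast
    have "\<exists>y. \<eta> y = beta ^ idx i" for i
    proof -
      have "beta ^ idx i \<in> \<eta> ` \<Lambda>" unfolding img using beta by (simp add: E_closed)
      then show ?thesis by auto
    qed
    then obtain b where "\<And>i. \<eta> (b i) = beta ^ idx i" by metis
    then have "u = \<eta> (\<Sum>i\<in>UNIV. (v $ i) *s b i)" by (simp add: v zeta0_def \<eta>sum)
    then show "u \<in> range \<eta>" by blast
  qed
  moreover then have "inj \<eta>"
    using card_L card_vec_all_in[of "UNIV :: 'a set", where 'n = 'n]
    by (intro eq_card_imp_inj_on) (auto simp: card_base card_index simp flip: power_mult)
  ultimately show "\<eta> \<in> Iso" by (simp add: Iso_def bij_betw_def add scale)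
qed

text \<open>
  A matrix that preserves the points of a subgeometry preserves its lattice after multiplication by
  a scalar, by the lemma on ratios. The resulting map \<open>T\<close> is bijective on a finite set, so it has
  finite order and an eigenfunctional, and the latter identifies \<open>V\<close> with \<open>L\<close> in such a way that the
  projectivity becomes a multiplication.
\<close>

lemma cyclic_partition_is_part:
  assumes "P \<in> cyclic_partitions q"
  shows "\<exists>\<zeta>\<in>Iso. P = block_partition \<zeta>"
proof -
  obtain \<rho> B where P: "P = determined_partition \<rho>" and \<rho>: "projectivity \<rho>"
    and "subgeometry q B" and cyc: "acts_cyclically \<rho> B"
    using assms unfolding cyclic_partitions_def by blast
  then obtain \<xi> where \<xi>: "\<xi> \<in> Iso" "B = subgeom \<xi>" using subgeometry_iff by blast
  obtain A where A: "invertible A" "\<And>U. U \<in> pg_points \<Longrightarrow> \<rho> U = (\<lambda>x. A *v x) ` U"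
    using \<rho> unfolding projectivity_def by blast
  have A0: "A *v x = 0 \<longleftrightarrow> x = 0" for x using invertible_injective[OF A(1), of x 0] by simp
  obtain x0 where x0: "\<xi> x0 = 1" using IsoD(7)[OF \<xi>(1) L_closed(7)] by blast
  then have x00: "x0 \<noteq> 0" using IsoD(6)[OF \<xi>(1)] by auto
  have AG: "\<xi> (A *v y) \<in> G" if "y \<noteq> 0" "\<xi> y \<in> E" for y
  proof -
    have "vec.span {y} \<in> B" using that by (auto simp: \<xi> subgeom_def)
    then have "\<rho> (vec.span {y}) \<in> B" using cyc by (auto simp: acts_cyclically_def)
    moreover have "\<rho> (vec.span {y}) = vec.span {A *v y}"
      using A(2) that by (subst A(2)) (auto simp: pg_points_eq matrix_image_span)
    ultimately show ?thesis using mem_subgeom[OF \<xi>(1)] A0 that by (simp add: \<xi>)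
  qed
  obtain a0 e0 where ae: "\<xi> (A *v x0) = to_ac a0 * e0" "a0 \<noteq> 0" "e0 \<in> E" "e0 \<noteq> 0"
    using AG[OF x00] x0 by (auto simp: G_def E_closed)
  define T where "T y = inverse a0 *s (A *v y)" for y
  have T_lin: "T (a *s y) = a *s T y" "T (y + z) = T y + T z" for a y z
    by (simp_all add: T_def vec.scale vec.add vector_smult_assoc mult.commute vector_add_ldistrib)
  have T0: "T y = 0 \<longleftrightarrow> y = 0" for y using ae A0 by (simp add: T_def)
  have injT: "inj T"
    using ae invertible_injective[OF A(1)] by (auto simp: inj_def T_def)
  have AT: "A *v y = a0 *s T y" for y using ae by (simp add: T_def vector_smult_assoc)
  have TE: "\<xi> (T y) \<in> E" if "\<xi> y \<in> E" for y
  proof -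
    \<comment> \<open>The matrix seen as a linear map of \<open>L\<close>.\<close>
    define psi where "psi u = \<xi> (A *v (SOME x. \<xi> x = u))" for u
    have psi: "psi (\<xi> x) = \<xi> (A *v x)" for x
    proof -
      have "(SOME x'. \<xi> x' = \<xi> x) = x" using IsoD(4)[OF \<xi>(1)] by simp
      then show ?thesis by (simp add: psi_def)
    qed
    have "psi (\<xi> y * 1) / psi 1 \<in> E"
    proof (rule ratio_in_E)
      fix u w assume "u \<in> L" "w \<in> L"
      then obtain x z where "u = \<xi> x" "w = \<xi> z" using IsoD(7)[OF \<xi>(1)] by metis
      then show "psi (u + w) = psi u + psi w"
        using psi[of "x + z"] by (simp add: psi IsoD(1)[OF \<xi>(1)] vec.add)
    next
      fix a u assume "u \<in> L"
      then obtain x where "u = \<xi> x" using IsoD(7)[OF \<xi>(1)] by metis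
      then show "psi (to_ac a * u) = to_ac a * psi u"
        using psi[of "a *s x"] by (simp add: psi IsoD(2)[OF \<xi>(1)] vec.scale)
    next
      fix u assume "u \<in> L" "psi u = 0"
      then obtain x where "u = \<xi> x" using IsoD(7)[OF \<xi>(1)] by metis
      then show "u = 0" using \<open>psi u = 0\<close> by (simp add: psi IsoD(5)[OF \<xi>(1)] A0)
    next
      fix e assume e: "e \<in> E" "e \<noteq> 0"
      then obtain x where x: "e = \<xi> x" using IsoD(7)[OF \<xi>(1)] E_sub_L by (metis subsetD)
      then have "x \<noteq> 0" using e IsoD(6)[OF \<xi>(1)] by auto
      then show "psi (e * 1) / psi 1 \<in> G"
        using AG[of x] AG[of x0] e x x0 x00 psi[of x0] by (simp add: psi E_closed G_divide)
    qed (use that in \<open>auto simp: L_closed\<close>)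
    then have "\<xi> (A *v y) / \<xi> (A *v x0) \<in> E"
      using psi[of x0] by (simp add: psi x0)
    then have "\<xi> (A *v y) / \<xi> (A *v x0) * e0 \<in> E" using ae(3) by (rule E_closed(2))
    moreover have "\<xi> (T y) = \<xi> (A *v y) / \<xi> (A *v x0) * e0"
      using ae by (simp add: T_def IsoD(2)[OF \<xi>(1)] field_simps)
    ultimately show ?thesis by simp
  qed
  have trans: "\<exists>s i. s \<noteq> 0 \<and> y = s *s (T ^^ i) x0" if y: "y \<noteq> 0" "\<xi> y \<in> E" for y
  proof -
    have "vec.span {x0} \<in> B" "vec.span {y} \<in> B" using x0 x00 y by (auto simp: \<xi> subgeom_def E_closed)
    then have "vec.span {y} \<in> orbit \<rho> (vec.span {x0})"
      using cyc by (auto simp: acts_cyclically_def cyclic_on_alldef)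
    then obtain i where "vec.span {y} = (\<rho> ^^ i) (vec.span {x0})" by (auto simp: orbit_altdef)
    then have "vec.span {((*v) A ^^ i) x0} = vec.span {y}" and "((*v) A ^^ i) x0 \<noteq> 0"
      using funpow_projectivity[OF A(2,1) x00] by simp_all
    then obtain s where s: "s \<noteq> 0" "y = s *s ((*v) A ^^ i) x0"
      using span_eq_iff[of "((*v) A ^^ i) x0" y] y by auto
    have "((*v) A ^^ i) x0 = a0 ^ i *s (T ^^ i) x0"
      by (induction i) (simp_all add: AT T_lin vector_smult_assoc mult.commute)
    then have "y = (s * a0 ^ i) *s (T ^^ i) x0" using s by (simp add: vector_smult_assoc)
    then show ?thesis using s ae by (intro exI[of _ "s * a0 ^ i"] exI[of _ i]) simp
  qed
  obtain r where r: "r > 0" "\<And>y. (T ^^ r) y = y" using injective_funpow_period[OF injT] by blast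
  obtain \<alpha> c M y1 where eig: "(\<Sum>i\<le>M. c i * \<xi> ((T ^^ i) y1)) \<noteq> 0"
    "\<And>y. (\<Sum>i\<le>M. c i * \<xi> ((T ^^ i) (T y))) = \<alpha> * (\<Sum>i\<le>M. c i * \<xi> ((T ^^ i) y))"
    by (rule exists_eigenfunctional[OF r, of \<xi> x0]) (use x0 in auto)
  define \<eta> where "\<eta> y = (\<Sum>i\<le>M. c i * \<xi> ((T ^^ i) y))" for y
  have Tn: "(T ^^ i) (a *s y) = a *s (T ^^ i) y" "(T ^^ i) (y + z) = (T ^^ i) y + (T ^^ i) z" for i a y z
    by (induction i) (simp_all add: T_lin)
  have \<eta>_add: "\<eta> (y + z) = \<eta> y + \<eta> z" for y z
    by (simp add: \<eta>_def Tn IsoD(1)[OF \<xi>(1)] algebra_simps sum.distrib)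
  have \<eta>_scale: "\<eta> (a *s y) = to_ac a * \<eta> y" for a y
    by (simp add: \<eta>_def Tn IsoD(2)[OF \<xi>(1)] sum_distrib_left mult_ac)
  have \<eta>T: "\<eta> (T y) = \<alpha> * \<eta> y" for y unfolding \<eta>_def by (rule eig(2))
  have y1: "\<eta> y1 \<noteq> 0" using eig(1) by (simp add: \<eta>_def)
  have \<eta>Ti: "\<eta> ((T ^^ i) y) = \<alpha> ^ i * \<eta> y" for i y by (induction i) (simp_all add: \<eta>T)
  have \<alpha>r: "\<alpha> ^ r = 1" using \<eta>Ti[of r y1] r(2) y1 by simp
  then have \<alpha>0: "\<alpha> \<noteq> 0" using r(1) by (auto simp: power_0_left)
  have \<eta>x0: "\<eta> x0 \<noteq> 0"
  proof
    assume "\<eta> x0 = 0"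
    then have van: "\<eta> y = 0" if "y \<noteq> 0" "\<xi> y \<in> E" for y
      using trans[OF that] by (auto simp: \<eta>_scale \<eta>Ti)
    obtain b where b: "\<And>i. \<xi> (b i) = beta ^ idx i" "\<And>y. \<exists>v. y = (\<Sum>i\<in>UNIV. v i *s b i)"
      using lattice_spans[OF \<xi>(1)] by blast
    have "\<eta> (b i) = 0" for i
    proof (rule van)
      have "\<xi> (b i) \<noteq> 0" unfolding b(1) using beta(2) by (rule power_not_zero)
      then show "b i \<noteq> 0" using IsoD(5)[OF \<xi>(1), of "b i"] by blast
      show "\<xi> (b i) \<in> E" unfolding b(1) using beta(1) by (rule E_closed(5))
    qed
    moreover obtain v where v: "y1 = (\<Sum>i\<in>UNIV. v i *s b i)" using b(2) by blast
    moreover have "\<eta> 0 = 0" using \<eta>_scale[of 0 0] by simp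
    ultimately have "\<eta> (\<Sum>i\<in>S. v i *s b i) = 0" for S
      by (induction S rule: infinite_finite_induct) (simp_all add: \<eta>_add \<eta>_scale)
    then have "\<eta> y1 = 0" unfolding v .
    then show False using y1 by contradiction
  qed
  define \<zeta> where "\<zeta> y = \<eta> y / \<eta> x0" for y
  have \<zeta>_add: "\<zeta> (y + z) = \<zeta> y + \<zeta> z" for y z by (simp add: \<zeta>_def \<eta>_add add_divide_distrib)
  have \<zeta>_scale: "\<zeta> (a *s y) = to_ac a * \<zeta> y" for a y by (simp add: \<zeta>_def \<eta>_scale)
  have \<zeta>T: "\<zeta> (T y) = \<alpha> * \<zeta> y" for y by (simp add: \<zeta>_def \<eta>T)
  have \<zeta>x0: "\<zeta> x0 = 1" using \<eta>x0 by (simp add: \<zeta>_def)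
  note facts = \<xi>(1) \<zeta>_add \<zeta>_scale \<zeta>T \<alpha>0 T_lin(1) x0 \<zeta>x0 TE trans
  have \<zeta>: "\<zeta> \<in> Iso" "\<alpha> \<in> E" "\<And>e. e \<in> E \<Longrightarrow> e \<noteq> 0 \<Longrightarrow> \<exists>s i. s \<noteq> 0 \<and> e = to_ac s * \<alpha> ^ i"
  proof -
    show "\<zeta> \<in> Iso"
      by (rule eigenfunctional_in_Iso(1)[where \<xi> = \<xi> and \<eta> = \<zeta> and T = T and \<alpha> = \<alpha> and ?x0.0 = x0])
        (fact facts)+
    show "\<alpha> \<in> E"
      by (rule eigenfunctional_in_Iso(2)[where \<xi> = \<xi> and \<eta> = \<zeta> and T = T and \<alpha> = \<alpha> and ?x0.0 = x0])
        (fact facts)+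
    show "\<exists>s i. s \<noteq> 0 \<and> e = to_ac s * \<alpha> ^ i" if "e \<in> E" "e \<noteq> 0" for e
      by (rule eigenfunctional_in_Iso(3)[where \<xi> = \<xi> and \<eta> = \<zeta> and T = T and \<alpha> = \<alpha> and ?x0.0 = x0])
        (fact facts that)+
  qed
  define \<alpha>' where "\<alpha>' = to_ac a0 * \<alpha>"
  have "determined_partition \<rho> = block_partition \<zeta>"
  proof (rule determined_partition_eq_part[where \<rho> = \<rho> and \<zeta> = \<zeta> and A = A and \<alpha> = \<alpha>', OF \<zeta>(1) A(2,1)])
    show "\<zeta> (A *v x) = \<alpha>' * \<zeta> x" for x
      by (simp add: AT \<zeta>_scale \<zeta>T \<alpha>'_def)
    show "\<alpha>' \<in> G" unfolding \<alpha>'_def using ae \<zeta>(2) \<alpha>0 by (intro G_I)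
    fix g assume "g \<in> G"
    then obtain a e where g: "g = to_ac a * e" "a \<noteq> 0" "e \<in> E" "e \<noteq> 0" by (auto simp: G_def)
    obtain s i where si: "s \<noteq> 0" "e = to_ac s * \<alpha> ^ i" using \<zeta>(3)[OF g(3,4)] by blast
    \<comment> \<open>Adding the period \<open>r\<close> makes the exponent positive.\<close>
    have "g = to_ac (a * s / a0 ^ (i + r)) * \<alpha>' ^ (i + r)"
      using ae \<alpha>r by (simp add: g si \<alpha>'_def power_mult_distrib power_add field_simps)
    then show "\<exists>s i. s \<noteq> 0 \<and> i > 0 \<and> g = to_ac s * \<alpha>' ^ i"
      using r(1) g si ae by (intro exI[of _ "a * s / a0 ^ (i + r)"] exI[of _ "i + r"]) simp
  qed
  then show ?thesis using \<zeta>(1) P by blast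
qed

lemma cyclic_partitions_eq: "cyclic_partitions q = block_partition ` Iso"
  using cyclic_partition_is_part part_in_cyclic_partitions by blast

end

section \<open>Counting invertible matrices; transitivity on pairs of points\<close>

lemma card_span_independent:
  fixes B :: "('a::{field,finite} ^ 'n) set"
  assumes "finite B" "vec.independent B"
  shows "card (vec.span B) = CARD('a) ^ card B"
  using assms
proof (induction B rule: finite_induct)
  case (insert b B)
  have b: "b \<notin> vec.span B" and B: "vec.independent B"
    using insert vec.independent_insert[of b B] by auto
  let ?f = "\<lambda>(c, y). c *s b + y"
  have "bij_betw ?f ((UNIV :: 'a set) \<times> vec.span B) (vec.span (insert b B))"
  proof (rule bij_betwI')
    fix u w assume "u \<in> (UNIV :: 'a set) \<times> vec.span B" "w \<in> (UNIV :: 'a set) \<times> vec.span B"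
    then obtain c y d z where uw: "u = (c, y)" "w = (d, z)" "y \<in> vec.span B" "z \<in> vec.span B" by auto
    show "?f u = ?f w \<longleftrightarrow> u = w"
    proof
      assume "?f u = ?f w"
      then have eq: "(c - d) *s b = z - y" by (simp add: uw algebra_simps)
      have "c = d"
      proof (rule ccontr)
        assume "c \<noteq> d"
        then have "b = inverse (c - d) *s (z - y)" by (simp add: vector_smult_assoc flip: eq)
        then show False using b uw by (metis vec.span_diff vec.span_scale)
      qed
      then show "u = w" using eq uw by simp
    qed simp
  next
    fix u :: "'a \<times> ('a ^ 'n)" assume "u \<in> UNIV \<times> vec.span B"
    then obtain c y where u: "u = (c, y)" "y \<in> vec.span B" by auto
    have "c *s b + y - c *s b = y" by simp
    then show "?f u \<in> vec.span (insert b B)"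
      using u(2) unfolding u(1) by (auto simp: vec.span_breakdown_eq intro!: exI[of _ c])
  next
    fix w assume "w \<in> vec.span (insert b B)"
    then obtain c where "w - c *s b \<in> vec.span B" by (auto simp: vec.span_breakdown_eq)
    then show "\<exists>u\<in>UNIV \<times> vec.span B. w = ?f u"
      by (intro bexI[of _ "(c, w - c *s b)"]) auto
  qed
  then have "card (vec.span (insert b B)) = CARD('a) * card (vec.span B)"
    by (metis bij_betw_same_card card_cartesian_product)
  then show ?case using insert B by simp
qed (simp add: vec.span_empty)

lemma card_independent_lists:
  "card {xs :: ('a::{field,finite} ^ 'n) list. length xs = m \<and> distinct xs \<and> vec.independent (set xs)}
     = (\<Prod>i<m. CARD('a) ^ CARD('n) - CARD('a) ^ i)"
proof (induction m)
  case 0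
  have "{xs :: ('a ^ 'n) list. length xs = 0 \<and> distinct xs \<and> vec.independent (set xs)} = {[]}" 
    by (auto simp: vec.independent_empty)
  then show ?case by simp
next
  case (Suc m)
  define I where "I m = {xs :: ('a ^ 'n) list. length xs = m \<and> distinct xs \<and> vec.independent (set xs)}" for m
  have fin: "finite (I m)" for m
    by (rule finite_subset[OF _ finite_lists_length_eq[of UNIV m]]) (auto simp: I_def)
  have "I (Suc m) = (\<lambda>(xs, x). x # xs) ` (SIGMA xs:I m. - vec.span (set xs))"
  proof (intro equalityI subsetI)
    fix ys assume "ys \<in> I (Suc m)"
    then obtain x xs where ys: "ys = x # xs" "length xs = m" "distinct xs" "x \<notin> set xs"
      "vec.independent (insert x (set xs))" by (auto simp: I_def length_Suc_conv)
    then show "ys \<in> (\<lambda>(xs, x). x # xs) ` (SIGMA xs:I m. - vec.span (set xs))"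
      by (auto simp: I_def vec.independent_insert image_iff)
  next
    fix ys assume "ys \<in> (\<lambda>(xs, x). x # xs) ` (SIGMA xs:I m. - vec.span (set xs))"
    then obtain x xs where ys: "ys = x # xs" "xs \<in> I m" "x \<notin> vec.span (set xs)" by auto
    then have "vec.independent (insert x (set xs))" "x \<notin> set xs"
      using vec.independent_insertI[of x "set xs"] vec.span_base[of x "set xs"] by (auto simp: I_def)
    then show "ys \<in> I (Suc m)" using ys by (simp add: I_def)
  qed
  moreover have "inj_on (\<lambda>(xs, x). x # xs) (SIGMA xs:I m. - vec.span (set xs))"
    by (auto simp: inj_on_def)
  ultimately have "card (I (Suc m)) = card (SIGMA xs:I m. - vec.span (set xs))"
    by (simp add: card_image)
  also have "\<dots> = (\<Sum>xs\<in>I m. card (- vec.span (set xs)))"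
    using fin by (intro card_SigmaI) auto
  also have "\<dots> = (\<Sum>xs\<in>I m. CARD('a) ^ CARD('n) - CARD('a) ^ m)"
  proof (rule sum.cong[OF refl])
    fix xs assume "xs \<in> I m"
    then have "card (vec.span (set xs)) = CARD('a) ^ m"
      using card_span_independent[of "set xs"] by (auto simp: I_def distinct_card)
    moreover have "CARD('a ^ 'n) = CARD('a) ^ CARD('n)"
      using card_vec_all_in[of "UNIV :: 'a set", where 'n = 'n] by simp
    ultimately show "card (- vec.span (set xs)) = CARD('a) ^ CARD('n) - CARD('a) ^ m"
      by (simp add: Compl_eq_Diff_UNIV card_Diff_subset)
  qed
  finally show ?case using Suc by (simp add: I_def mult.commute)
qed

lemma card_invertible_matrices:
  "card {A :: 'a::{field,finite} ^ 'n ^ 'n. invertible A}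
     = (\<Prod>i<CARD('n). CARD('a) ^ CARD('n) - CARD('a) ^ i)"
proof -
  let ?N = "CARD('n)"
  define I where "I = {xs :: ('a ^ 'n) list. length xs = ?N \<and> distinct xs \<and> vec.independent (set xs)}"
  obtain h where h: "bij_betw h {..<?N} (UNIV :: 'n set)"
    using finite_same_card_bij[of "{..<?N}" "UNIV :: 'n set"] by auto
  have h_img: "h ` {..<?N} = UNIV" using h by (simp add: bij_betw_def)
  define f where "f A = map (\<lambda>i. column (h i) A) [0..<?N]" for A :: "'a ^ 'n ^ 'n"
  have set_f: "set (f A) = columns A" for A
  proof -
    have "columns A = (\<lambda>l. column l A) ` h ` {..<?N}" by (auto simp: columns_def h_img)
    then show ?thesis by (simp add: f_def image_image atLeast0LessThan)
  qed
  have len: "length (f A) = ?N" for A by (simp add: f_def)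
  have inv_iff: "invertible A \<longleftrightarrow> f A \<in> I" for A
  proof -
    have "invertible A \<longleftrightarrow> vec.span (columns A) = UNIV"
      by (simp add: invertible_right_inverse matrix_right_invertible_span_columns)
    also have "\<dots> \<longleftrightarrow> f A \<in> I"
    proof
      assume span: "vec.span (columns A) = UNIV"
      have "?N \<le> card (columns A)"
        using vec.dim_le_card[of UNIV "columns A"] span by (simp add: vec_dim_card del: vec.dim_UNIV flip: set_f)
      moreover have "card (columns A) \<le> ?N" using card_length[of "f A"] len unfolding set_f by simp
      ultimately have card: "card (columns A) = ?N" by simp
      then have "vec.independent (columns A)"
        using vec.card_le_dim_spanning[of "columns A" UNIV] span by (simp add: vec_dim_card del: vec.dim_UNIV flip: set_f)
      then show "f A \<in> I" using card card_distinct[of "f A"] by (simp add: I_def set_f len)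
    next
      assume "f A \<in> I"
      then have "vec.independent (columns A)" "card (columns A) = ?N"
        using distinct_card[of "f A"] by (auto simp: I_def set_f)
      then show "vec.span (columns A) = UNIV"
        using vec.card_ge_dim_independent[of "columns A" UNIV] by (auto simp: vec_dim_card simp del: vec.dim_UNIV)
    qed
    finally show ?thesis .
  qed
  have "inj f"
  proof (rule injI)
    fix A B assume "f A = f B"
    then have "column (h i) A = column (h i) B" if "i < ?N" for i using that by (auto simp: f_def)
    then have "column l A = column l B" for l using h_img by (metis UNIV_I image_iff lessThan_iff)
    then show "A = B" by (simp add: column_def vec_eq_iff)
  qed
  moreover have "f ` {A. invertible A} = I"
  proof (intro equalityI subsetI)
    fix xs assume xs: "xs \<in> I"
    define A :: "'a ^ 'n ^ 'n" where "A = (\<chi> r l. (xs ! inv_into {..<?N} h l) $ r)"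
    have "column (h i) A = xs ! i" if "i < ?N" for i
      using that h by (simp add: A_def column_def bij_betw_def vec_eq_iff)
    then have "f A = xs" using xs by (intro nth_equalityI) (auto simp: f_def I_def)
    then show "xs \<in> f ` {A. invertible A}" using xs inv_iff by blast
  qed (use inv_iff in auto)
  ultimately have "card {A :: 'a ^ 'n ^ 'n. invertible A} = card I"
    by (metis card_image inj_on_subset subset_UNIV)
  then show ?thesis by (simp add: I_def card_independent_lists)
qed

lemma independent_pair:
  fixes x y :: "'a::field ^ 'n"
  assumes "x \<noteq> 0" "y \<notin> vec.span {x}"
  shows "vec.independent {y, x}" "x \<noteq> y"
proof -
  show "x \<noteq> y" using assms vec.span_base[of x "{x}"] by auto
  have "vec.independent {x}" using assms(1) by simp
  then show "vec.independent {y, x}" using assms(2) by (auto simp: vec.independent_insert)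
qed

lemma invertible_two_transitive:
  fixes x y x' y' :: "'a::field ^ 'n"
  assumes "x \<noteq> 0" "y \<notin> vec.span {x}" "x' \<noteq> 0" "y' \<notin> vec.span {x'}"
  shows "\<exists>A. invertible A \<and> A *v x = x' \<and> A *v y = y'"
proof -
  note ind = independent_pair[OF assms(1,2)] and ind' = independent_pair[OF assms(3,4)]
  define f where "f z = (if z = x then x' else y')" for z
  have "f ` {y, x} = {y', x'}" "inj_on f {y, x}" using ind ind' by (auto simp: f_def inj_on_def)
  then obtain g where g: "Vector_Spaces.linear (*s) (*s) g" "inj g" "\<forall>z\<in>{y, x}. g z = f z"
    using vec.linear_independent_extend_inj[of "{y, x}" f] ind ind' by auto
  have "\<exists>A. invertible A \<and> (\<forall>z. A *v z = g z)"
    using injective_linear_matrix[of g] g(1,2) by (simp add: Vector_Spaces.linear_iff)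
  then show ?thesis using g(3) ind by (auto simp: f_def)
qed

section \<open>Counting partitions and the pairs that they join\<close>

context singer_tower
begin

lemma card_V: "CARD('a ^ 'n) = (q ^ k) ^ N"
  using card_vec_all_in[of "UNIV :: 'a set", where 'n = 'n] by (simp add: card_base card_index)

lemma card_Iso: "card Iso = (\<Prod>i<N. (q ^ k) ^ N - (q ^ k) ^ i)"
proof -
  let ?f = "\<lambda>(A :: 'a ^ 'n ^ 'n) x. zeta0 (A *v x)"
  have "inj ?f"
  proof (rule injI)
    fix A B assume "?f A = ?f B"
    then have "A *v x = B *v x" for x using inj_zeta0 by (metis injD)
    then show "A = B" by (simp add: matrix_eq)
  qed
  moreover have "?f ` {A. invertible A} = Iso"
  proof (intro equalityI subsetI)
    fix \<zeta> assume "\<zeta> \<in> Iso"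
    then obtain A where "invertible A" "\<And>x. zeta0 (A *v x) = \<zeta> x" using Iso_eq_matrix[OF zeta0_Iso] by blast
    then show "\<zeta> \<in> ?f ` {A. invertible A}" by (intro image_eqI[of _ _ A]) auto
  qed (auto intro: Iso_comp_matrix[OF zeta0_Iso])
  ultimately have "card Iso = card {A :: 'a ^ 'n ^ 'n. invertible A}"
    by (metis card_image inj_on_subset subset_UNIV)
  then show ?thesis by (simp add: card_invertible_matrices card_base card_index)
qed

lemma Q_gt1: "q ^ k > 1"
  using one_less_power[OF q_gt1, of k] k_gt1 by simp

lemma finite_Iso: "finite Iso"
proof -
  have "(q ^ k) ^ N - (q ^ k) ^ i > 0" if "i < N" for i
    using power_strict_increasing[OF that Q_gt1] by simp
  then have "card Iso > 0" unfolding card_Iso by (intro prod_pos) auto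
  then show ?thesis by (rule card_ge_0_finite)
qed

text \<open>
  The map \<open>(a, e) \<mapsto> a e\<close> has fibres of size \<open>q - 1\<close>, since \<open>E\<close> meets \<open>F\<close> in \<open>GF(q)\<close>.
\<close>

lemma card_G: "(q - 1) * card G = (q ^ k - 1) * (q ^ N - 1)"
proof -
  let ?S = "(UNIV - {0 :: 'a}) \<times> (E - {0})"
  let ?m = "\<lambda>(a, e). to_ac a * e"
  have img: "?m ` ?S = G" by (force simp: G_def)
  have "card {u \<in> ?S. ?m u = ?m w} = q - 1" if wS: "w \<in> ?S" for w
  proof -
    obtain b f where w: "w = (b, f)" "b \<noteq> 0" "f \<in> E" "f \<noteq> 0" using wS by auto
    let ?h = "\<lambda>s. (b * s, f / to_ac s)"
    have "{u \<in> ?S. ?m u = ?m w} = ?h ` (Fq - {0})"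
    proof (intro equalityI subsetI)
      fix u assume "u \<in> {u \<in> ?S. ?m u = ?m w}"
      then obtain a e where u: "u = (a, e)" "a \<noteq> 0" "e \<in> E" "e \<noteq> 0" "to_ac a * e = to_ac b * f"
        using w by auto
      have eq: "to_ac (a / b) = f / e" using u w by (simp add: field_simps)
      then have "to_ac (a / b) \<in> E" using u w by (simp only: E_closed)
      then have "a / b \<in> Fq" using E_inter_F[OF _ to_ac_in_gf] by (simp only: Fq_iff)
      moreover have "u = ?h (a / b)" unfolding eq using u(1,2,4) w by simp
      ultimately show "u \<in> ?h ` (Fq - {0})" using u w by (intro image_eqI[of _ _ "a / b"]) auto
    next
      fix u assume "u \<in> ?h ` (Fq - {0})"
      then obtain s where s: "u = ?h s" "s \<in> Fq" "s \<noteq> 0" by auto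
      then have "to_ac s \<in> E" using gf_q_sub(1) by (auto simp: Fq_iff)
      then show "u \<in> {u \<in> ?S. ?m u = ?m w}" using s w by (auto simp: E_closed)
    qed
    moreover have "inj_on ?h (Fq - {0})" using w by (auto simp: inj_on_def)
    moreover have "card (Fq - {0}) = q - 1" using card_Fq by (simp add: Fq_def)
    ultimately show ?thesis by (simp add: card_image)
  qed
  then have "card ?S = (q - 1) * card (?m ` ?S)"
    using card_E(2) by (intro card_fibres) auto
  moreover have "card ?S = (q ^ k - 1) * (q ^ N - 1)"
    using card_E by (simp add: card_cartesian_product card_base E_closed)
  ultimately show ?thesis by (simp add: img)
qed

lemma card_point_nonzero:
  fixes x :: "'a ^ 'n"
  assumes "x \<noteq> 0"
  shows "card {y. y \<noteq> 0 \<and> vec.span {y} = vec.span {x}} = q ^ k - 1"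
proof -
  have "{y. y \<noteq> 0 \<and> vec.span {y} = vec.span {x}} = (\<lambda>a. a *s x) ` (UNIV - {0})"
  proof (rule Set.set_eqI)
    fix y
    show "y \<in> {y. y \<noteq> 0 \<and> vec.span {y} = vec.span {x}} \<longleftrightarrow> y \<in> (\<lambda>a. a *s x) ` (UNIV - {0})"
      using span_eq_iff[OF assms, of y] assms eq_commute[of "vec.span {y}" "vec.span {x}"]
      by (cases "y = 0") (auto simp: image_iff simp del: vec.span_eq)
  qed
  moreover have "inj_on (\<lambda>a. a *s x) (UNIV - {0})"
    using assms by (auto simp: inj_on_def)
  ultimately show ?thesis by (simp add: card_image card_base)
qed

lemma card_points_of_vectors:
  assumes "\<And>x. x \<in> S \<Longrightarrow> x \<noteq> 0" and "\<And>a x. x \<in> S \<Longrightarrow> a \<noteq> 0 \<Longrightarrow> a *s x \<in> S"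
  shows "card S = (q ^ k - 1) * card ((\<lambda>x :: 'a ^ 'n. vec.span {x}) ` S)"
proof (rule card_fibres)
  fix x assume x: "x \<in> S"
  have "{y \<in> S. vec.span {y} = vec.span {x}} = {y. y \<noteq> 0 \<and> vec.span {y} = vec.span {x}}"
  proof (intro equalityI subsetI)
    fix y assume y: "y \<in> {y. y \<noteq> 0 \<and> vec.span {y} = vec.span {x}}"
    then obtain a where "a \<noteq> 0" "y = a *s x" using span_eq_iff[of x y] assms(1)[OF x] by auto
    then show "y \<in> {y \<in> S. vec.span {y} = vec.span {x}}" using y assms(2)[OF x] by simp
  qed (use assms(1) in auto)
  then show "card {y \<in> S. vec.span {y} = vec.span {x}} = q ^ k - 1"
    using card_point_nonzero[OF assms(1)[OF x]] by simp
qed simp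

lemma card_pg_points: "(q ^ k - 1) * card (pg_points :: ('a ^ 'n) set set) = (q ^ k) ^ N - 1"
proof -
  have "card (UNIV - {0 :: 'a ^ 'n}) = (q ^ k - 1) * card ((\<lambda>x :: 'a ^ 'n. vec.span {x}) ` (UNIV - {0}))"
    by (rule card_points_of_vectors) auto
  moreover have "(\<lambda>x :: 'a ^ 'n. vec.span {x}) ` (UNIV - {0}) = pg_points" by (auto simp: pg_points_eq)
  ultimately show ?thesis by (simp add: card_base card_index)
qed

lemma card_class:
  assumes \<zeta>: "\<zeta> \<in> Iso" and x: "x \<noteq> 0"
  shows "card {y. y \<noteq> 0 \<and> \<zeta> y / \<zeta> x \<in> G} = card G"
proof -
  have \<zeta>x: "\<zeta> x \<noteq> 0" using x IsoD(5)[OF \<zeta>] by simp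
  have "bij_betw (\<lambda>y. \<zeta> y / \<zeta> x) {y. y \<noteq> 0 \<and> \<zeta> y / \<zeta> x \<in> G} G"
    unfolding bij_betw_def
  proof
    show "inj_on (\<lambda>y. \<zeta> y / \<zeta> x) {y. y \<noteq> 0 \<and> \<zeta> y / \<zeta> x \<in> G}"
      using \<zeta>x IsoD(4)[OF \<zeta>] by (auto simp: inj_on_def)
    show "(\<lambda>y. \<zeta> y / \<zeta> x) ` {y. y \<noteq> 0 \<and> \<zeta> y / \<zeta> x \<in> G} = G"
    proof (intro equalityI subsetI)
      fix g assume g: "g \<in> G"
      then obtain y where y: "\<zeta> y = g * \<zeta> x" 
        using IsoD(7)[OF \<zeta> L_closed(2)[OF _ IsoD(3)[OF \<zeta>]], of g x] G_sub_L by blast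
      then have "\<zeta> y / \<zeta> x = g" "\<zeta> y \<noteq> 0" using \<zeta>x g G_nonzero by auto
      then show "g \<in> (\<lambda>y. \<zeta> y / \<zeta> x) ` {y. y \<noteq> 0 \<and> \<zeta> y / \<zeta> x \<in> G}"
        using g IsoD(6)[OF \<zeta>] by (intro image_eqI[of _ _ y]) auto
    qed auto
  qed
  then show ?thesis by (rule bij_betw_same_card)
qed

lemma card_block:
  assumes "\<zeta> \<in> Iso" "x \<noteq> 0"
  shows "(q ^ k - 1) * card (block \<zeta> x) = card G"
proof -
  let ?S = "{y. y \<noteq> 0 \<and> \<zeta> y / \<zeta> x \<in> G}"
  have "card ?S = (q ^ k - 1) * card ((\<lambda>y. vec.span {y}) ` ?S)"
  proof (rule card_points_of_vectors)
    fix a :: 'a and y assume "y \<in> ?S" and a: "a \<noteq> 0"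
    then have "to_ac a * (\<zeta> y / \<zeta> x) \<in> G" using G_mult[OF to_ac_G[OF a]] by blast
    then show "a *s y \<in> ?S" using \<open>y \<in> ?S\<close> a by (simp add: IsoD(2)[OF assms(1)])
  qed simp
  moreover have "(\<lambda>y. vec.span {y}) ` ?S = block \<zeta> x" by (auto simp: block_def)
  ultimately show ?thesis by (simp add: card_class[OF assms])
qed

lemma self_mem_block:
  assumes "\<zeta> \<in> Iso" "x \<noteq> 0"
  shows "vec.span {x} \<in> block \<zeta> x"
  using mem_block[OF assms assms(2)] assms IsoD(5)[OF assms(1), of x] E_sub_G[OF E_closed(7)] by simp

lemma mem_partition_factor:
  assumes \<zeta>: "\<zeta> \<in> Iso" and x: "x \<noteq> 0" and y: "y \<noteq> 0" and ne: "vec.span {x} \<noteq> vec.span {y}"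
  shows "{vec.span {x}, vec.span {y}} \<in> partition_factor (block_partition \<zeta>) \<longleftrightarrow> \<zeta> y / \<zeta> x \<in> G"
proof
  assume "{vec.span {x}, vec.span {y}} \<in> partition_factor (block_partition \<zeta>)"
  then obtain z where z: "z \<noteq> 0" "vec.span {x} \<in> block \<zeta> z" "vec.span {y} \<in> block \<zeta> z"
    by (auto simp: partition_factor_def block_partition_def complete_graph_def)
  then have "(\<zeta> y / \<zeta> z) / (\<zeta> x / \<zeta> z) \<in> G" using mem_block[OF \<zeta> z(1)] x y G_divide by blast
  then show "\<zeta> y / \<zeta> x \<in> G" using z(1) IsoD(5)[OF \<zeta>, of z] by simp
next
  assume "\<zeta> y / \<zeta> x \<in> G"
  then have "vec.span {y} \<in> block \<zeta> x" using mem_block[OF \<zeta> x y] by simp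
  then show "{vec.span {x}, vec.span {y}} \<in> partition_factor (block_partition \<zeta>)"
    using self_mem_block[OF \<zeta> x] ne x
    by (auto simp: partition_factor_def block_partition_def complete_graph_def intro!: bexI[of _ x])
qed

definition same_classes where
  "same_classes \<zeta> \<zeta>' \<longleftrightarrow> (\<forall>x y. x \<noteq> 0 \<longrightarrow> y \<noteq> 0 \<longrightarrow> (\<zeta> y / \<zeta> x \<in> G \<longleftrightarrow> \<zeta>' y / \<zeta>' x \<in> G))"

lemma part_eq_if_same_classes: "same_classes \<zeta> \<zeta>' \<Longrightarrow> block_partition \<zeta> = block_partition \<zeta>'"
proof -
  assume same: "same_classes \<zeta> \<zeta>'"
  have "block \<zeta> x = block \<zeta>' x" if "x \<noteq> 0" for x
  proof -
    have "y \<noteq> 0 \<and> \<zeta> y / \<zeta> x \<in> G \<longleftrightarrow> y \<noteq> 0 \<and> \<zeta>' y / \<zeta>' x \<in> G" for y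
      using same that unfolding same_classes_def by blast
    then show ?thesis unfolding block_def by simp
  qed
  then show ?thesis unfolding block_partition_def by (intro image_cong) auto
qed

text \<open>
  The edges of the factor together with equality of points recover the equivalence relation.
\<close>

lemma same_classes_if_factor_eq:
  assumes "\<zeta> \<in> Iso" "\<zeta>' \<in> Iso" and eq: "partition_factor (block_partition \<zeta>) = partition_factor (block_partition \<zeta>')"
  shows "same_classes \<zeta> \<zeta>'"
  unfolding same_classes_def
proof (intro allI impI)
  fix x y :: "'a ^ 'n" assume x: "x \<noteq> 0" and y: "y \<noteq> 0"
  show "\<zeta> y / \<zeta> x \<in> G \<longleftrightarrow> \<zeta>' y / \<zeta>' x \<in> G"
  proof (cases "vec.span {x} = vec.span {y}")
    case True
    then have "vec.span {y} \<in> block \<zeta> x" "vec.span {y} \<in> block \<zeta>' x"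
      using self_mem_block[OF assms(1) x] self_mem_block[OF assms(2) x] by auto
    then show ?thesis using mem_block[OF assms(1) x y] mem_block[OF assms(2) x y] by simp
  next
    case False
    then show ?thesis
      using mem_partition_factor[OF assms(1) x y] mem_partition_factor[OF assms(2) x y] eq by simp
  qed
qed

lemma part_eq_iff_same_classes:
  assumes "\<zeta> \<in> Iso" "\<zeta>' \<in> Iso"
  shows "block_partition \<zeta> = block_partition \<zeta>' \<longleftrightarrow> same_classes \<zeta> \<zeta>'"
proof
  assume "block_partition \<zeta> = block_partition \<zeta>'"
  then show "same_classes \<zeta> \<zeta>'" by (intro same_classes_if_factor_eq assms) simp
qed (rule part_eq_if_same_classes)

lemma inj_partition_factor: "inj_on partition_factor (block_partition ` Iso)"
proof (rule inj_onI)
  fix P P' assume P: "P \<in> block_partition ` Iso" "P' \<in> block_partition ` Iso" "partition_factor P = partition_factor P'"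
  then obtain \<zeta> \<zeta>' where "\<zeta> \<in> Iso" "\<zeta>' \<in> Iso" "P = block_partition \<zeta>" "P' = block_partition \<zeta>'" by blast
  then show "P = P'" using same_classes_if_factor_eq part_eq_if_same_classes P(3) by blast
qed

text \<open>
  The group of maps \<open>u \<mapsto> c u\<^sup>s\<close> of \<open>L\<close>, with \<open>s\<close> a power of \<open>Q\<close>, acts on the identifications; it is
  the normalizer of the multiplicative group of \<open>E\<close> in the \<open>F\<close>-linear group of \<open>L\<close>.
\<close>

definition twist :: "('a ^ 'n \<Rightarrow> 'a alg_closure) \<Rightarrow> 'a alg_closure \<times> nat \<Rightarrow> 'a ^ 'n \<Rightarrow> 'a alg_closure" where
  "twist \<zeta> = (\<lambda>(c, i) x. c * \<zeta> x ^ (q ^ (k * i)))"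

lemma twist_in_Iso:
  assumes \<zeta>: "\<zeta> \<in> Iso" and c: "c \<in> L" "c \<noteq> 0"
  shows "twist \<zeta> (c, i) \<in> Iso"
proof -
  have inj: "inj (twist \<zeta> (c, i))"
    using c IsoD(4)[OF \<zeta>] by (auto simp: twist_def frob_inj intro: injI)
  have "range (twist \<zeta> (c, i)) = L"
  proof (rule card_subset_eq)
    show "range (twist \<zeta> (c, i)) \<subseteq> L" using c IsoD(3)[OF \<zeta>] by (auto simp: twist_def L_closed)
    show "card (range (twist \<zeta> (c, i))) = card L"
      using card_image[OF inj] card_V card_L by (simp add: power_mult)
  qed (rule card_L)
  moreover have "twist \<zeta> (c, i) (x + y) = twist \<zeta> (c, i) x + twist \<zeta> (c, i) y" for x y
    by (simp add: twist_def IsoD(1)[OF \<zeta>] frob_add distrib_left)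
  moreover have "twist \<zeta> (c, i) (a *s x) = to_ac a * twist \<zeta> (c, i) x" for a x
    by (simp add: twist_def IsoD(2)[OF \<zeta>] power_mult_distrib frob_linear)
  ultimately show ?thesis using inj by (simp add: Iso_def bij_betw_def)
qed

lemma G_frob_iff:
  assumes "x \<in> L" "i \<le> N"
  shows "x ^ (q ^ (k * i)) \<in> G \<longleftrightarrow> x \<in> G"
proof
  assume "x ^ (q ^ (k * i)) \<in> G"
  then have "(x ^ (q ^ (k * i))) ^ (q ^ (k * (N - i))) \<in> G" by (rule G_frob)
  moreover have "(x ^ (q ^ (k * i))) ^ (q ^ (k * (N - i))) = x"
    using assms by (simp add: L_def gf_def flip: power_mult power_add distrib_left)
  ultimately show "x \<in> G" by simp
qed (rule G_frob)

lemma same_classes_iff_twist: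
  assumes \<zeta>: "\<zeta> \<in> Iso" and \<zeta>': "\<zeta>' \<in> Iso"
  shows "same_classes \<zeta> \<zeta>' \<longleftrightarrow> \<zeta>' \<in> twist \<zeta> ` ((L - {0}) \<times> {..<N})"
proof
  assume same: "same_classes \<zeta> \<zeta>'"
  define psi where "psi u = \<zeta>' (SOME x. \<zeta> x = u)" for u
  have psi: "psi (\<zeta> x) = \<zeta>' x" for x
  proof -
    have "(SOME x'. \<zeta> x' = \<zeta> x) = x" using IsoD(4)[OF \<zeta>] by simp
    then show ?thesis by (simp add: psi_def)
  qed
  have "\<exists>c i. c \<in> L \<and> c \<noteq> 0 \<and> i < N \<and> (\<forall>u\<in>L. psi u = c * u ^ (q ^ (k * i)))"
  proof (rule partition_preserving_semilinear)
    fix u w assume "u \<in> L" "w \<in> L"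
    then obtain x y where xy: "u = \<zeta> x" "w = \<zeta> y" using IsoD(7)[OF \<zeta>] by metis
    show "psi (u + w) = psi u + psi w"
      using psi[of "x + y"] by (simp add: xy psi IsoD(1)[OF \<zeta>] IsoD(1)[OF \<zeta>'])
    assume "u \<noteq> 0" "w / u \<in> G"
    moreover from this have "w \<noteq> 0" using G_nonzero by auto
    ultimately have "x \<noteq> 0" "y \<noteq> 0" "\<zeta> y / \<zeta> x \<in> G" using IsoD(5)[OF \<zeta>] by (simp_all add: xy)
    then show "psi w / psi u \<in> G"
      using same unfolding same_classes_def by (simp add: xy psi)
  next
    fix a u assume "u \<in> L"
    then obtain x where x: "u = \<zeta> x" using IsoD(7)[OF \<zeta>] by metis
    show "psi (to_ac a * u) = to_ac a * psi u"
      using psi[of "a *s x"] by (simp add: x psi IsoD(2)[OF \<zeta>] IsoD(2)[OF \<zeta>'])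
    show "psi u \<in> L" using IsoD(3)[OF \<zeta>'] by (simp add: x psi)
    assume "psi u = 0"
    then show "u = 0" using IsoD(5)[OF \<zeta>] IsoD(5)[OF \<zeta>'] by (simp add: x psi)
  qed
  then obtain c i where ci: "c \<in> L" "c \<noteq> 0" "i < N" "\<forall>u\<in>L. psi u = c * u ^ (q ^ (k * i))" by blast
  have "\<zeta>' = twist \<zeta> (c, i)" using ci(4) IsoD(3)[OF \<zeta>] psi by (auto simp: twist_def fun_eq_iff)
  then show "\<zeta>' \<in> twist \<zeta> ` ((L - {0}) \<times> {..<N})" using ci by blast
next
  assume "\<zeta>' \<in> twist \<zeta> ` ((L - {0}) \<times> {..<N})"
  then obtain c i where ci: "c \<noteq> 0" "i < N" "\<zeta>' = twist \<zeta> (c, i)" by auto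
  have "\<zeta>' y / \<zeta>' x = (\<zeta> y / \<zeta> x) ^ (q ^ (k * i))" for x y
    using ci by (simp add: twist_def power_divide)
  then show "same_classes \<zeta> \<zeta>'"
    using G_frob_iff[OF L_closed(3)[OF IsoD(3)[OF \<zeta>] IsoD(3)[OF \<zeta>]]] ci(2)
    by (simp add: same_classes_def)
qed

lemma card_same_part:
  assumes \<zeta>: "\<zeta> \<in> Iso"
  shows "card {\<zeta>' \<in> Iso. block_partition \<zeta>' = block_partition \<zeta>} = N * ((q ^ k) ^ N - 1)"
proof -
  let ?D = "(L - {0}) \<times> {..<N}"
  have "{\<zeta>' \<in> Iso. block_partition \<zeta>' = block_partition \<zeta>} = {\<zeta>' \<in> Iso. \<zeta>' \<in> twist \<zeta> ` ?D}"
  proof (rule Collect_cong, rule conj_cong[OF refl])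
    fix \<zeta>' assume "\<zeta>' \<in> Iso"
    then show "block_partition \<zeta>' = block_partition \<zeta> \<longleftrightarrow> \<zeta>' \<in> twist \<zeta> ` ?D"
      using part_eq_iff_same_classes[OF \<zeta>] same_classes_iff_twist[OF \<zeta>] by (metis (no_types))
  qed
  also have "\<dots> = twist \<zeta> ` ?D" using twist_in_Iso[OF \<zeta>] by auto
  finally have "{\<zeta>' \<in> Iso. block_partition \<zeta>' = block_partition \<zeta>} = twist \<zeta> ` ?D" .
  moreover have "inj_on (twist \<zeta>) ?D"
  proof (rule inj_onI)
    fix u w assume D: "u \<in> ?D" "w \<in> ?D" "twist \<zeta> u = twist \<zeta> w"
    then obtain c i d l where uw: "u = (c, i)" "w = (d, l)" "c \<noteq> 0" "i < N" "l < N" by auto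
    obtain x where x: "\<zeta> x = 1" using IsoD(7)[OF \<zeta> L_closed(7)] by blast
    obtain y where y: "\<zeta> y = beta" using IsoD(7)[OF \<zeta>] beta(1) E_sub_L by blast
    have "c = d" using fun_cong[OF D(3), of x] by (simp add: uw twist_def x)
    moreover have "c * beta ^ (q ^ (k * i)) = d * beta ^ (q ^ (k * l))"
      using fun_cong[OF D(3), of y] by (simp add: uw twist_def y)
    ultimately have "beta ^ (q ^ (k * i)) = beta ^ (q ^ (k * l))" using uw by simp
    then have "i = l" using beta_conjugates_distinct uw by (auto simp: inj_on_def)
    then show "u = w" using \<open>c = d\<close> uw by simp
  qed
  ultimately have "card {\<zeta>' \<in> Iso. block_partition \<zeta>' = block_partition \<zeta>} = card ?D" by (simp add: card_image)
  also have "\<dots> = N * ((q ^ k) ^ N - 1)"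
    using card_L by (simp add: card_cartesian_product L_closed power_mult)
  finally show ?thesis .
qed

lemma card_parts_joining:
  fixes x y :: "'a ^ 'n"
  assumes x: "x \<noteq> 0" and y: "y \<noteq> 0" and ne: "vec.span {x} \<noteq> vec.span {y}"
  shows "card {\<zeta> \<in> Iso. \<zeta> y / \<zeta> x \<in> G}
    = N * ((q ^ k) ^ N - 1) * card {P \<in> block_partition ` Iso. {vec.span {x}, vec.span {y}} \<in> partition_factor P}"
proof -
  let ?S = "{\<zeta> \<in> Iso. \<zeta> y / \<zeta> x \<in> G}"
  have img: "block_partition ` ?S = {P \<in> block_partition ` Iso. {vec.span {x}, vec.span {y}} \<in> partition_factor P}"
    using mem_partition_factor[OF _ x y ne] by auto
  have "card ?S = N * ((q ^ k) ^ N - 1) * card (block_partition ` ?S)"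
  proof (rule card_fibres)
    fix \<zeta> assume \<zeta>: "\<zeta> \<in> ?S"
    have "{\<zeta>' \<in> ?S. block_partition \<zeta>' = block_partition \<zeta>} = {\<zeta>' \<in> Iso. block_partition \<zeta>' = block_partition \<zeta>}"
      using \<zeta> mem_partition_factor[OF _ x y ne] by auto metis
    then show "card {\<zeta>' \<in> ?S. block_partition \<zeta>' = block_partition \<zeta>} = N * ((q ^ k) ^ N - 1)"
      using card_same_part \<zeta> by simp
  qed (use finite_Iso in simp)
  then show ?thesis by (simp add: img)
qed

text \<open>
  Invertible matrices act on the identifications by composition and are transitive on pairs of
  distinct points; exchanging the pairs turns this inequality into an equality.
\<close>

lemma card_joining_independent_of_pair:
  fixes x y x' y' :: "'a ^ 'n"
  assumes "x \<noteq> 0" "y \<notin> vec.span {x}" "x' \<noteq> 0" "y' \<notin> vec.span {x'}"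
  shows "card {\<zeta> \<in> Iso. \<zeta> y / \<zeta> x \<in> G} \<le> card {\<zeta> \<in> Iso. \<zeta> y' / \<zeta> x' \<in> G}"
proof -
  obtain A where A: "invertible A" "A *v x' = x" "A *v y' = y"
    using invertible_two_transitive[OF assms(3,4,1,2)] by blast
  let ?f = "\<lambda>\<zeta> z. \<zeta> (A *v z)"
  have "\<exists>w. z = A *v w" for z
    using A(1) by (metis invertible_right_inverse matrix_right_invertible_surjective surjD)
  then have "inj ?f" by (intro injI ext) metis
  moreover have "?f ` {\<zeta> \<in> Iso. \<zeta> y / \<zeta> x \<in> G} \<subseteq> {\<zeta> \<in> Iso. \<zeta> y' / \<zeta> x' \<in> G}"
    using Iso_comp_matrix[OF _ A(1)] A by auto
  ultimately show ?thesis
    using finite_Iso by (intro card_inj_on_le[of ?f]) (auto intro: inj_on_subset)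
qed

text \<open>
  Double counting, for a fixed \<open>x\<close>, of the pairs of an identification and a vector that lies in the
  class of \<open>x\<close> but is not a multiple of \<open>x\<close>.
\<close>

lemma card_joining:
  fixes x y :: "'a ^ 'n"
  assumes x: "x \<noteq> 0" and y: "y \<notin> vec.span {x}"
  shows "((q ^ k) ^ N - q ^ k) * card {\<zeta> \<in> Iso. \<zeta> y / \<zeta> x \<in> G} = card Iso * (card G - (q ^ k - 1))"
proof -
  let ?Y = "- vec.span {x}" and ?c = "card {\<zeta> \<in> Iso. \<zeta> y / \<zeta> x \<in> G}"
  have card_span: "card (vec.span {x}) = q ^ k"
    using card_span_independent[of "{x}"] x by (simp add: card_base)
  have cls: "card {z \<in> ?Y. \<zeta> z / \<zeta> x \<in> G} = card G - (q ^ k - 1)" if \<zeta>: "\<zeta> \<in> Iso" for \<zeta>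
  proof -
    have eq: "{z \<in> ?Y. \<zeta> z / \<zeta> x \<in> G} = {z. z \<noteq> 0 \<and> \<zeta> z / \<zeta> x \<in> G} - (vec.span {x} - {0})"
      using IsoD(6)[OF \<zeta>] G_nonzero vec.span_zero by auto
    have "vec.span {x} - {0} \<subseteq> {z. z \<noteq> 0 \<and> \<zeta> z / \<zeta> x \<in> G}"
      using x IsoD(5)[OF \<zeta>, of x] by (auto simp: vec.span_singleton IsoD(2)[OF \<zeta>] to_ac_G)
    then have "card {z \<in> ?Y. \<zeta> z / \<zeta> x \<in> G} = card G - card (vec.span {x} - {0})"
      unfolding eq by (subst card_Diff_subset) (auto simp: card_class[OF \<zeta> x])
    then show ?thesis by (simp add: card_span vec.span_zero)
  qed
  have const: "card {\<zeta> \<in> Iso. \<zeta> z / \<zeta> x \<in> G} = ?c" if "z \<in> ?Y" for z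
    using card_joining_independent_of_pair[OF x y x, of z]
      card_joining_independent_of_pair[OF x _ x y, of z] that by auto
  have "(\<Sum>z\<in>?Y. card {\<zeta> \<in> Iso. \<zeta> z / \<zeta> x \<in> G}) = (\<Sum>\<zeta>\<in>Iso. card {z \<in> ?Y. \<zeta> z / \<zeta> x \<in> G})"
    using finite_Iso by (intro sum_multicount_gen) auto
  also have "\<dots> = (\<Sum>\<zeta>\<in>Iso. card G - (q ^ k - 1))" by (rule sum.cong[OF refl cls])
  finally have "card ?Y * ?c = card Iso * (card G - (q ^ k - 1))"
    by (simp add: const)
  moreover have "card ?Y = (q ^ k) ^ N - q ^ k"
    by (simp add: Compl_eq_Diff_UNIV card_Diff_subset card_base card_index card_span)
  ultimately show ?thesis by simp
qed

end

section \<open>The factorization\<close>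

lemma prod_power_differences:
  fixes Q :: real
  shows "(\<Prod>i<N. Q ^ N - Q ^ i) = Q ^ (N choose 2) * (\<Prod>i=1..N. Q ^ i - 1)"
proof (induction N)
  case (Suc N)
  have "(\<Prod>i<Suc N. Q ^ Suc N - Q ^ i) = (Q ^ Suc N - 1) * (\<Prod>i<N. Q * (Q ^ N - Q ^ i))"
    by (simp only: prod.lessThan_Suc_shift) (simp add: right_diff_distrib)
  also have "\<dots> = (Q ^ Suc N - 1) * Q ^ N * (\<Prod>i<N. Q ^ N - Q ^ i)"
    by (simp add: prod.distrib)
  also have "\<dots> = Q ^ (Suc N choose 2) * (\<Prod>i=1..Suc N. Q ^ i - 1)"
    by (simp add: Suc numeral_2_eq_2 power_add)
  finally show ?case .
qed (simp add: numeral_2_eq_2)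

context singer_tower
begin

lemma block_sub_points: "block \<zeta> x \<subseteq> pg_points"
  by (auto simp: block_def pg_points_eq)

lemma edges_at_point:
  assumes \<zeta>: "\<zeta> \<in> Iso" and x: "x \<noteq> 0"
  shows "{e \<in> partition_factor (block_partition \<zeta>). vec.span {x} \<in> e}
    = (\<lambda>W. {vec.span {x}, W}) ` (block \<zeta> x - {vec.span {x}})"
proof (intro equalityI subsetI)
  fix e assume "e \<in> {e \<in> partition_factor (block_partition \<zeta>). vec.span {x} \<in> e}"
  then have e: "e \<in> partition_factor (block_partition \<zeta>)" "vec.span {x} \<in> e" by auto
  then obtain z where z: "e \<subseteq> block \<zeta> z" "card e = 2"
    by (auto simp: partition_factor_def block_partition_def complete_graph_def)
  then obtain W where W: "e = {vec.span {x}, W}" "W \<noteq> vec.span {x}"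
    using e(2) by (auto simp: card_2_iff)
  then obtain y where y: "W = vec.span {y}" "y \<noteq> 0" using z(1) by (auto simp: block_def)
  then have "W \<in> block \<zeta> x"
    using mem_partition_factor[OF \<zeta> x y(2)] mem_block[OF \<zeta> x y(2)] e(1) W by auto
  then show "e \<in> (\<lambda>W. {vec.span {x}, W}) ` (block \<zeta> x - {vec.span {x}})" using W by auto
next
  fix e assume "e \<in> (\<lambda>W. {vec.span {x}, W}) ` (block \<zeta> x - {vec.span {x}})"
  then obtain W where W: "e = {vec.span {x}, W}" "W \<in> block \<zeta> x" "W \<noteq> vec.span {x}" by auto
  then obtain y where y: "W = vec.span {y}" "y \<noteq> 0" by (auto simp: block_def)
  then show "e \<in> {e \<in> partition_factor (block_partition \<zeta>). vec.span {x} \<in> e}"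
    using mem_partition_factor[OF \<zeta> x y(2)] mem_block[OF \<zeta> x y(2)] W by auto
qed

lemma card_block_eq:
  assumes "\<zeta> \<in> Iso" "x \<noteq> 0"
  shows "(q - 1) * card (block \<zeta> x) = q ^ N - 1"
proof -
  have "(q ^ k - 1) * ((q - 1) * card (block \<zeta> x)) = (q ^ k - 1) * (q ^ N - 1)"
    using card_block[OF assms] card_G by (simp add: mult.left_commute)
  moreover have "q ^ k - 1 \<noteq> 0" using Q_gt1 by simp
  ultimately show ?thesis by (simp only: mult_cancel1) simp
qed

text \<open>
  The neighbours of a point are the other points of its part, so \<open>Suc m\<close> is the size of a part.
\<close>

lemma is_factor_part:
  assumes \<zeta>: "\<zeta> \<in> Iso" and m: "(q - 1) * Suc m = q ^ N - 1"
  shows "is_factor m pg_points (partition_factor (block_partition \<zeta>))"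
  unfolding is_factor_def
proof (intro conjI ballI)
  show "simple_graph pg_points (partition_factor (block_partition \<zeta>))"
    using block_sub_points
    by (fastforce simp: simple_graph_def partition_factor_def block_partition_def complete_graph_def)
next
  fix U :: "('a ^ 'n) set" assume "U \<in> pg_points"
  then obtain x where x: "U = vec.span {x}" "x \<noteq> 0" by (auto simp: pg_points_eq)
  have "inj_on (\<lambda>W. {U, W}) (block \<zeta> x - {U})" by (auto simp: inj_on_def doubleton_eq_iff)
  then have "card {e \<in> partition_factor (block_partition \<zeta>). U \<in> e} = card (block \<zeta> x - {U})"
    using edges_at_point[OF \<zeta> x(2)] x(1) by (simp add: card_image)
  also have "\<dots> = card (block \<zeta> x) - 1" using self_mem_block[OF \<zeta> x(2)] x(1) by simp
  also have "\<dots> = m"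
  proof -
    have "(q - 1) * card (block \<zeta> x) = (q - 1) * Suc m" using card_block_eq[OF \<zeta> x(2)] m by simp
    then show ?thesis using q_gt1 by (simp only: mult_cancel1) auto
  qed
  finally show "card {e \<in> partition_factor (block_partition \<zeta>). U \<in> e} = m" .
qed

text \<open>
  The second hypothesis is the double count for \<open>lam\<close>: every partition arises from
  \<open>N * (Q ^ N - 1)\<close> identifications, and the factor \<open>Q ^ N - Q\<close> is the number of vectors that are not
  multiples of a given one.
\<close>

lemma simple_factorization:
  assumes m: "(q - 1) * Suc m = q ^ N - 1"
    and lam: "N * ((q ^ k) ^ N - 1) * ((q ^ k) ^ N - q ^ k) * lam = card Iso * (card G - (q ^ k - 1))"
  shows "is_simple_factorization m lam (pg_points :: ('a ^ 'n) set set) (cyclic_factors q)"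
proof -
  have fin: "finite (block_partition ` Iso)" using finite_Iso by simp
  have factors: "cyclic_factors q = mset_set (partition_factor ` block_partition ` Iso)"
    unfolding cyclic_factors_def cyclic_partitions_eq
    by (rule image_mset_mset_set[OF inj_partition_factor])
  have joined: "size {# F \<in># cyclic_factors q. {U, W} \<in> F #} = lam"
    if UW: "U \<in> pg_points" "W \<in> pg_points" "U \<noteq> W" for U W :: "('a ^ 'n) set"
  proof -
    obtain x y where xy: "U = vec.span {x}" "x \<noteq> 0" "W = vec.span {y}" "y \<noteq> 0"
      using UW by (auto simp: pg_points_eq)
    define l where "l = card {P \<in> block_partition ` Iso. {U, W} \<in> partition_factor P}"
    have yx: "y \<notin> vec.span {x}"
    proof
      assume "y \<in> vec.span {x}"
      then obtain a where "y = a *s x" by (auto simp: vec.span_singleton)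
      then have "vec.span {x} = vec.span {y}" using span_eq_iff[OF xy(2,4)] xy(4) by auto
      then show False using UW(3) xy by simp
    qed
    then have "((q ^ k) ^ N - q ^ k) * (N * ((q ^ k) ^ N - 1) * l) = card Iso * (card G - (q ^ k - 1))"
      using card_joining[OF xy(2) yx] card_parts_joining[OF xy(2,4)] UW(3) xy(1,3) by (simp add: l_def)
    then have "(N * ((q ^ k) ^ N - 1) * ((q ^ k) ^ N - q ^ k)) * l
        = (N * ((q ^ k) ^ N - 1) * ((q ^ k) ^ N - q ^ k)) * lam"
      by (simp only: lam) (simp only: mult_ac)
    moreover have "(q ^ k) ^ 1 < (q ^ k) ^ N"
      using Q_gt1 N_gt1 by (rule power_strict_increasing[rotated])
    then have "N * ((q ^ k) ^ N - 1) * ((q ^ k) ^ N - q ^ k) \<noteq> 0" using N_gt1 Q_gt1 by simp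
    ultimately have l: "l = lam" by (simp only: mult_cancel1) simp
    have "size {# F \<in># cyclic_factors q. {U, W} \<in> F #}
        = card {F \<in> partition_factor ` block_partition ` Iso. {U, W} \<in> F}"
      using fin by (simp add: factors filter_mset_mset_set)
    also have "{F \<in> partition_factor ` block_partition ` Iso. {U, W} \<in> F}
        = partition_factor ` {P \<in> block_partition ` Iso. {U, W} \<in> partition_factor P}" by auto
    also have "card \<dots> = l"
      unfolding l_def by (rule card_image[OF inj_on_subset[OF inj_partition_factor]]) auto
    finally show ?thesis by (simp add: l)
  qed
  have "is_factorization m lam (pg_points :: ('a ^ 'n) set set) (cyclic_factors q)"
    unfolding is_factorization_def
    using joined is_factor_part[OF _ m] fin by (auto simp: factors)
  then show ?thesis
    unfolding is_simple_factorization_def using fin by (auto simp: factors)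
qed

lemma factorization_parameters:
  obtains lam v m :: nat where
    "real lam = (real q ^ ((N choose 2) * k) * (real q ^ k - 1) * (real q ^ (N - 1) - 1))
                  / (real q ^ (k - 1) * real N * (real q - 1))
                  * (\<Prod>i = 1..N - 2. real q ^ (k * i) - 1)"
    "real v = (real q ^ (k * N) - 1) / (real q ^ k - 1)"
    "real m = real q * ((real q ^ (N - 1) - 1) / (real q - 1))"
    "card (pg_points :: ('a ^ 'n) set set) = v"
    "is_simple_factorization m lam (pg_points :: ('a ^ 'n) set set) (cyclic_factors q)"
proof -
  obtain n where n: "N = Suc n" "n > 0" using N_gt1 by (cases N) auto
  obtain j' where j': "n = Suc j'" using n by (cases n) auto
  define Q :: real where "Q = real q ^ k"
  have q1: "real q > 1" using q_gt1 by simp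
  have Q1: "Q > 1" using q1 k_gt1 by (simp add: Q_def)
  have Qn: "Q ^ n > 1" "Q ^ N > 1" using one_less_power[OF Q1, of n] one_less_power[OF Q1, of N] n by simp_all
  have Q_split: "Q = real q ^ (k - 1) * real q"
    using k_gt1 by (simp add: Q_def power_Suc2[symmetric] del: power_Suc)
  have Q_nat: "real (q ^ k) = Q" by (simp add: Q_def)
  \<comment> \<open>Any nonzero vector \<open>x\<close>, and below any \<open>y\<close> outside its span, serves to read off the parameters.\<close>
  define x :: "'a ^ 'n" where "x = axis undefined 1"
  have x: "x \<noteq> 0" by (simp add: x_def axis_eq_0_iff)
  define v where "v = card (pg_points :: ('a ^ 'n) set set)"
  have "(Q - 1) * real v = Q ^ N - 1"
  proof -
    have "real ((q ^ k - 1) * v) = real ((q ^ k) ^ N - 1)" by (simp only: v_def card_pg_points)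
    then show ?thesis using Q_gt1 by (simp add: of_nat_diff Q_def)
  qed
  then have v: "real v = (Q ^ N - 1) / (Q - 1)" using Q1 by (simp add: field_simps)
  define b where "b = card (block zeta0 x)"
  have b: "(q - 1) * b = q ^ N - 1" unfolding b_def by (rule card_block_eq[OF zeta0_Iso x])
  have "q ^ N > 1" using one_less_power[OF q_gt1] N_gt1 by simp
  then have "b > 0" using b by (cases b) auto
  then obtain m where m: "b = Suc m" by (cases b) auto
  have "(real q - 1) * (real m + 1) = real q ^ N - 1"
  proof -
    have "real ((q - 1) * b) = real (q ^ N - 1)" by (simp only: b)
    then have "real (q - 1) * real b = real (q ^ N - 1)" by (simp only: of_nat_mult)
    then show ?thesis using q_gt1 \<open>q ^ N > 1\<close> by (simp add: of_nat_diff m add.commute)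
  qed
  then have m_real: "real m = real q * ((real q ^ n - 1) / (real q - 1))"
    using q1 by (simp add: field_simps n)
  have "\<exists>y. y \<notin> vec.span {x}"
  proof -
    have "card (vec.span {x}) = q ^ k" using card_span_independent[of "{x}"] x by (simp add: card_base)
    moreover have "(q ^ k) ^ 1 < (q ^ k) ^ N"
      using Q_gt1 N_gt1 by (rule power_strict_increasing[rotated])
    ultimately have "vec.span {x} \<noteq> UNIV" using card_V by auto
    then show ?thesis by auto
  qed
  then obtain y where y: "y \<notin> vec.span {x}" by blast
  have y0: "y \<noteq> 0" using y vec.span_zero by auto
  have ne: "vec.span {x} \<noteq> vec.span {y}" using y vec.span_base[of y "{y}"] by auto
  define lam where "lam = card {P \<in> block_partition ` Iso. {vec.span {x}, vec.span {y}} \<in> partition_factor P}"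
  have lam: "N * ((q ^ k) ^ N - 1) * ((q ^ k) ^ N - q ^ k) * lam = card Iso * (card G - (q ^ k - 1))"
    using card_joining[OF x y] card_parts_joining[OF x y0 ne] by (simp add: lam_def mult_ac)
  have fac: "is_simple_factorization m lam (pg_points :: ('a ^ 'n) set set) (cyclic_factors q)"
    by (rule simple_factorization[OF _ lam]) (use b m in simp)
  define P where "P = (\<Prod>i=1..j'. Q ^ i - 1)"
  have "card G = (q ^ k - 1) * b" using card_block[OF zeta0_Iso x] by (simp add: b_def)
  then have "card G - (q ^ k - 1) = (q ^ k - 1) * m" by (simp add: m)
  then have "real (N * ((q ^ k) ^ N - 1) * ((q ^ k) ^ N - q ^ k) * lam) = real (card Iso * ((q ^ k - 1) * m))"
    by (simp only: lam)
  moreover have "q ^ k \<le> (q ^ k) ^ N" using Q_gt1 N_gt1 by (intro self_le_power) auto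
  ultimately have "real N * (Q ^ N - 1) * (Q ^ N - Q) * real lam = real (card Iso) * ((Q - 1) * real m)"
    using Q_gt1 by (simp add: of_nat_diff Q_def)
  moreover have "real (card Iso) = Q ^ (N choose 2) * (P * (Q ^ n - 1) * (Q ^ N - 1))"
  proof -
    have "(q ^ k) ^ i \<le> (q ^ k) ^ N" if "i < N" for i using that Q_gt1 by (intro power_increasing) auto
    then have "real (card Iso) = (\<Prod>i<N. Q ^ N - Q ^ i)"
      unfolding card_Iso of_nat_prod by (intro prod.cong) (simp_all add: of_nat_diff Q_def)
    also have "\<dots> = Q ^ (N choose 2) * (P * (Q ^ n - 1) * (Q ^ N - 1))"
      unfolding prod_power_differences n(1) j' P_def by (simp add: mult_ac)
    finally show ?thesis .
  qed
  moreover have "Q ^ N - Q = Q * (Q ^ n - 1)" by (simp add: n algebra_simps)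
  ultimately have "(Q ^ N - 1) * (Q ^ n - 1) * (real N * Q * real lam)
      = (Q ^ N - 1) * (Q ^ n - 1) * (Q ^ (N choose 2) * P * ((Q - 1) * real m))"
    by (simp add: mult_ac)
  then have key: "real N * Q * real lam = Q ^ (N choose 2) * P * ((Q - 1) * real m)"
    using Qn by simp
  have "real lam = (Q ^ (N choose 2) * (Q - 1) * (real q ^ n - 1))
      / (real q ^ (k - 1) * real N * (real q - 1)) * P"
  proof -
    \<comment> \<open>Here \<open>D * a\<close> stands for \<open>Q = q ^ (k - 1) * q\<close>, so that one factor \<open>q\<close> cancels against \<open>m\<close>.\<close>
    have solve: "l = w * z * u / (D * r * b) * P"
      if "r * (D * a) * l = w * P * (z * (a * (u / b)))" "r \<noteq> 0" "D \<noteq> 0" "a \<noteq> 0" "b \<noteq> 0"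
      for l w z u D r a b :: real
      using that by (simp add: field_simps)
    have "real N * (real q ^ (k - 1) * real q) * real lam
        = Q ^ (N choose 2) * P * ((Q - 1) * (real q * ((real q ^ n - 1) / (real q - 1))))"
      using key by (simp only: m_real flip: Q_split)
    then show ?thesis by (rule solve) (use q1 n in auto)
  qed
  then have "real lam = (real q ^ ((N choose 2) * k) * (real q ^ k - 1) * (real q ^ (N - 1) - 1))
      / (real q ^ (k - 1) * real N * (real q - 1)) * (\<Prod>i = 1..N - 2. real q ^ (k * i) - 1)"
    by (simp add: P_def Q_def n j' power_mult mult.commute[of _ k])
  moreover have "real v = (real q ^ (k * N) - 1) / (real q ^ k - 1)"
    using v by (simp only: Q_def power_mult)
  moreover have "real m = real q * ((real q ^ (N - 1) - 1) / (real q - 1))"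
    using m_real by (simp add: n)
  ultimately show ?thesis by (rule that[OF _ _ _ v_def[symmetric] fac])
qed

end

theorem theorem4p11:
  fixes q k n :: nat
  assumes "primepow q" and "k > 1" and "n > 0" and "gcd k (n + 1) = 1"
    and "CARD('a::{field,finite}) = q ^ k" and "CARD('n::finite) = n + 1"
  shows "\<exists>lam v m :: nat.
     real lam = (real q ^ (((n + 1) choose 2) * k) * (real q ^ k - 1) * (real q ^ n - 1))
                  / (real q ^ (k - 1) * real (n + 1) * (real q - 1))
                  * (\<Prod>i = 1..n - 1. real q ^ (k * i) - 1) \<and>
     real v = (real q ^ (k * (n + 1)) - 1) / (real q ^ k - 1) \<and>
     real m = real q * ((real q ^ n - 1) / (real q - 1)) \<and>
     card (pg_points :: ('a ^ 'n) set set) = v \<and>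
     is_simple_factorization m lam (pg_points :: ('a ^ 'n) set set) (cyclic_factors q)"
proof -
  obtain p j where pj: "normalization_semidom_class.prime p" "j > 0" "q = p ^ j"
    using assms(1) by (auto simp: primepow_def)
  have prime_char: "normalization_semidom_class.prime CHAR('a)"
    using finite_imp_CHAR_pos[where 'a = 'a] prime_CHAR_semidom[where 'a = 'a] by simp
  have "CHAR('a) dvd p ^ (j * k)"
    using CHAR_dvd_CARD[where 'a = 'a] assms(5) pj(3) by (simp add: power_mult)
  then have "CHAR('a) = p"
    using prime_char pj(1) prime_dvd_power primes_dvd_imp_eq by blast
  then interpret singer_tower q j k "n + 1" "TYPE('a)" "TYPE('n)"
    using assms pj by unfold_locales auto
  obtain lam v m where
    "real lam = (real q ^ (((n + 1) choose 2) * k) * (real q ^ k - 1) * (real q ^ (n + 1 - 1) - 1))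
                  / (real q ^ (k - 1) * real (n + 1) * (real q - 1))
                  * (\<Prod>i = 1..n + 1 - 2. real q ^ (k * i) - 1)"
    "real v = (real q ^ (k * (n + 1)) - 1) / (real q ^ k - 1)"
    "real m = real q * ((real q ^ (n + 1 - 1) - 1) / (real q - 1))"
    "card (pg_points :: ('a ^ 'n) set set) = v"
    "is_simple_factorization m lam (pg_points :: ('a ^ 'n) set set) (cyclic_factors q)"
    by (rule factorization_parameters)
  moreover have "n + 1 - 1 = n" "n + 1 - 2 = n - 1" by simp_all
  ultimately show ?thesis by (simp only:) blast
qed

end
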